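(* Let $\mathbb F_q$ be a finite field of characteristic $2$, and let $W$ and $W'$ be $\mathbb F_q$-vector spaces of odd dimensions $n\le n'$, each equipped with a nondegenerate nonalternating symmetric bilinear form. For $0\le k\le\lfloor n/2\rfloor$ let $S_k$ be a maximal totally isotropic subspace of $V=W\perp W'$ with $\dim(S_k\cap W)=k$ (unique up to the action of $\operatorname{Aut}(W)\perp\operatorname{Aut}(W')$). Then the number of isometries in $\operatorname{Aut}(W)\perp\operatorname{Aut}(W')$ stabilizing $S_k$ is $$\#\operatorname{Aut}(S_k)=q^{(n'-1)^2/4+k(n-k-1)}\prod_{i=1}^{k}(q^i-1)\prod_{i=1}^{k+(n'-n)/2}(q^i-1)\prod_{i=1}^{(n-1)/2-k}(q^{2i}-1)$$ and $$\sum_{k=0}^{(n-1)/2}\frac{1}{\#\operatorname{Aut}(S_k)}=\frac{\prod_{i=1}^{(n+n')/2-1}(q^i+1)}{q^{(n-1)^2/4+(n'-1)^2/4}\prod_{i=1}^{(n-1)/2}(q^{2i}-1)\prod_{i=1}^{(n'-1)/2}(q^{2i}-1)} .$$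
   Context: A symmetric bilinear form $b$ is alternating if $b(v,v)=0$ for all $v$, and nonalternating otherwise. $W\perp W'$ is the orthogonal direct sum; $W,W'$ are identified with subspaces of it. A subspace is totally isotropic if the form vanishes identically on it. $\operatorname{Aut}(W)$, $\operatorname{Aut}(W')$ are isometry groups, $\operatorname{Aut}(W)\perp\operatorname{Aut}(W')$ is their direct product acting componentwise on $W\perp W'$, and $\operatorname{Aut}(S_k)$ denotes the stabilizer of $S_k$ in this group. *)

theory Defs
  imports "HOL-Analysis.Analysis" "HOL-Computational_Algebra.Computational_Algebra"
begin

(* Vector spaces are entire types: "s" is the scalar multiplication, "b" a form.
   A hypothesis bilinear_form s b includes vector_space s, via Vector_Spaces.linear. *)

definition bilinear_form ::
    "('a::field \<Rightarrow> 'v::ab_group_add \<Rightarrow> 'v) \<Rightarrow> ('v \<Rightarrow> 'v \<Rightarrow> 'a) \<Rightarrow> bool" where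
  "bilinear_form s b \<longleftrightarrow>
     (\<forall>x. Vector_Spaces.linear s (*) (\<lambda>y. b x y)) \<and>
     (\<forall>y. Vector_Spaces.linear s (*) (\<lambda>x. b x y))"

definition symmetric_form :: "('v \<Rightarrow> 'v \<Rightarrow> 'a) \<Rightarrow> bool" where
  "symmetric_form b \<longleftrightarrow> (\<forall>x y. b x y = b y x)"

definition nondegenerate_form :: "('v::zero \<Rightarrow> 'v \<Rightarrow> 'a::zero) \<Rightarrow> bool" where
  "nondegenerate_form b \<longleftrightarrow> (\<forall>x. (\<forall>y. b x y = 0) \<longrightarrow> x = 0)"

definition alternating_form :: "('v \<Rightarrow> 'v \<Rightarrow> 'a::zero) \<Rightarrow> bool" where
  "alternating_form b \<longleftrightarrow> (\<forall>v. b v v = 0)"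

(* The orthogonal direct sum lives on the product type, with scalar multiplication
   module_prod.scale s s'. The first summand is identified with UNIV \<times> {0}. *)
definition perp_form ::
    "('v \<Rightarrow> 'v \<Rightarrow> 'a::plus) \<Rightarrow> ('w \<Rightarrow> 'w \<Rightarrow> 'a) \<Rightarrow> 'v \<times> 'w \<Rightarrow> 'v \<times> 'w \<Rightarrow> 'a" where
  "perp_form b b' = (\<lambda>x y. b (fst x) (fst y) + b' (snd x) (snd y))"

definition totally_isotropic ::
    "('a::field \<Rightarrow> 'v::ab_group_add \<Rightarrow> 'v) \<Rightarrow> ('v \<Rightarrow> 'v \<Rightarrow> 'a) \<Rightarrow> 'v set \<Rightarrow> bool" where
  "totally_isotropic s b S \<longleftrightarrow> module.subspace s S \<and> (\<forall>x\<in>S. \<forall>y\<in>S. b x y = 0)"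

definition maximal_totally_isotropic ::
    "('a::field \<Rightarrow> 'v::ab_group_add \<Rightarrow> 'v) \<Rightarrow> ('v \<Rightarrow> 'v \<Rightarrow> 'a) \<Rightarrow> 'v set \<Rightarrow> bool" where
  "maximal_totally_isotropic s b S \<longleftrightarrow>
     totally_isotropic s b S \<and> (\<forall>T. totally_isotropic s b T \<longrightarrow> S \<subseteq> T \<longrightarrow> T = S)"

definition isometries ::
    "('a::field \<Rightarrow> 'v::ab_group_add \<Rightarrow> 'v) \<Rightarrow> ('v \<Rightarrow> 'v \<Rightarrow> 'a) \<Rightarrow> ('v \<Rightarrow> 'v) set" where
  "isometries s b =
     {g. Vector_Spaces.linear s s g \<and> bij g \<and> (\<forall>x y. b (g x) (g y) = b x y)}"

(* In general a proper subgroup of the isometries of perp_form b b'. *)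
definition perp_isometries ::
    "('a::field \<Rightarrow> 'v::ab_group_add \<Rightarrow> 'v) \<Rightarrow> ('v \<Rightarrow> 'v \<Rightarrow> 'a) \<Rightarrow>
     ('a \<Rightarrow> 'w::ab_group_add \<Rightarrow> 'w) \<Rightarrow> ('w \<Rightarrow> 'w \<Rightarrow> 'a) \<Rightarrow> ('v \<times> 'w \<Rightarrow> 'v \<times> 'w) set" where
  "perp_isometries s b s' b' =
     {map_prod g g' | g g'. g \<in> isometries s b \<and> g' \<in> isometries s' b'}"

definition perp_stabilizer ::
    "('a::field \<Rightarrow> 'v::ab_group_add \<Rightarrow> 'v) \<Rightarrow> ('v \<Rightarrow> 'v \<Rightarrow> 'a) \<Rightarrow>
     ('a \<Rightarrow> 'w::ab_group_add \<Rightarrow> 'w) \<Rightarrow> ('w \<Rightarrow> 'w \<Rightarrow> 'a) \<Rightarrow>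
     ('v \<times> 'w) set \<Rightarrow> ('v \<times> 'w \<Rightarrow> 'v \<times> 'w) set" where
  "perp_stabilizer s b s' b' S = {f \<in> perp_isometries s b s' b'. f ` S = S}"

definition max_isotropic_meeting ::
    "('a::field \<Rightarrow> 'v::ab_group_add \<Rightarrow> 'v) \<Rightarrow> ('v \<Rightarrow> 'v \<Rightarrow> 'a) \<Rightarrow>
     ('a \<Rightarrow> 'w::ab_group_add \<Rightarrow> 'w) \<Rightarrow> ('w \<Rightarrow> 'w \<Rightarrow> 'a) \<Rightarrow>
     nat \<Rightarrow> ('v \<times> 'w) set \<Rightarrow> bool" where
  "max_isotropic_meeting s b s' b' k S \<longleftrightarrow>
     maximal_totally_isotropic (module_prod.scale s s') (perp_form b b') S \<and>
     vector_space.dim (module_prod.scale s s') (S \<inter> (UNIV \<times> {0})) = k"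

end

theory Submission
  imports Defs
begin

text \<open>
In a nondegenerate space of odd dimension over a finite field of characteristic 2 there is a unique
\<open>e\<close> with \<open>b v v = (b v e)\<^sup>2\<close> for all \<open>v\<close>, and \<open>b e e = 1\<close>; hence isometries are the same as isometries
of the symplectic space \<open>U\<close>, the orthogonal complement of \<open>e\<close>. A totally isotropic subspace of the
orthogonal sum is maximal iff it equals its own orthogonal complement; it then contains \<open>e + e'\<close>, and so
it is spanned by \<open>e + e'\<close> and a Lagrangian \<open>L\<close> of the orthogonal sum of \<open>U\<close> and \<open>U'\<close>.

Fixing symplectic bases (``frames'') of \<open>U\<close> and \<open>U'\<close>, the group becomes the set of all pairs of frames.
Every \<open>L\<close> is in normal form with respect to some pair of frames, which gives transitivity, and the
stabilizer of \<open>L\<close> corresponds to the pairs adapted to \<open>L\<close>. These are counted recursively by splitting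
off hyperbolic planes. Every pair of frames is adapted to exactly one \<open>L\<close> of each type, so the
number of \<open>L\<close> of type \<open>k\<close> times the order of the stabilizer is the order of the group. Summing over \<open>k\<close>, the
mass is the number of all Lagrangians divided by the order of the group.
\<close>

subsection \<open>Lagrangians of symplectic spaces in characteristic 2\<close>

text \<open>The vector \<open>e\<close> comes from Frobenius: in characteristic 2 the map v -> b v v
  is additive, and squaring is an automorphism of a finite field, so the square root of b v v is a
  linear functional, which nondegeneracy represents by some \<open>e\<close>. Then
  \<open>b e e\<close> is its own square; the value 0 would make b v w + b v e * b w e a
  nondegenerate alternating form on a space of odd dimension. The obstacle is that a vector
  orthogonal to an isotropic subspace need not be isotropic, so maximality does not give
  self-orthogonality at once; in the sum, isotropy is decided by pairing with \<open>e + e'\<close>.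
  The role of Witt extension is played by frames: the group acts simply transitively on pairs of
  frames, so a stabilizer becomes a set of pairs, and the existence of a normal form follows from a
  count being positive. Sizes of subspaces are kept as powers of q rather than dimensions, so that
  each recursion is a bijection of finite sets. The numerator of the mass is the number of
  Lagrangians of a symplectic space of dimension 2N, the product of the q^i + 1 for i up to N, with
  N = (n + n')/2 - 1.\<close>

locale char2_form = vector_space s
  for s :: "'a::{field,finite} \<Rightarrow> 'z::ab_group_add \<Rightarrow> 'z" +
  fixes b :: "'z \<Rightarrow> 'z \<Rightarrow> 'a"
  assumes char2: "(1::'a) + 1 = 0"
    and finite_UNIV_vec: "finite (UNIV :: 'z set)"
    and bilinear: "bilinear_form s b"
    and symmetric: "symmetric_form b"
begin

lemma finite_vec [simp]: "finite (A :: 'z set)"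
  using finite_UNIV_vec finite_subset subset_UNIV by blast

lemma finite_vec_sets [simp]: "finite (\<A> :: 'z set set)"
  by (rule finite_subset[OF subset_UNIV]) (simp add: Finite_Set.finite_set)

lemma scalar_double [simp]: "(c::'a) + c = 0" "(c::'a) + (c + d) = d"
proof -
  have "c + c = c * (1 + 1)" by (simp only: distrib_left mult_1_right)
  then show "c + c = 0" by (simp only: char2 mult_zero_right)
  then show "c + (c + d) = d" by (simp add: add.assoc[symmetric])
qed

lemma vector_double [simp]: "(v::'z) + v = 0" "(v::'z) + (v + w) = w"
proof -
  have "v + v = s (1 + 1) v" by (simp only: scale_left_distrib scale_one)
  then show "v + v = 0" by (simp only: char2 scale_zero_left)
  then show "v + (v + w) = w" by (simp add: add.assoc[symmetric])
qed

lemma scalar_add_eq_0 [simp]: "(c::'a) + d = 0 \<longleftrightarrow> c = d"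
  by (metis scalar_double(1) add_left_cancel)

lemma form_add [simp]: "b (x + y) z = b x z + b y z" "b z (x + y) = b z x + b z y"
  using bilinear by (auto simp: bilinear_form_def Vector_Spaces.linear_def module_hom_def module_hom_axioms_def)

lemma form_scale [simp]: "b (s c x) z = c * b x z" "b z (s c x) = c * b z x"
  using bilinear by (auto simp: bilinear_form_def Vector_Spaces.linear_def module_hom_def module_hom_axioms_def)

lemma form_zero [simp]: "b 0 z = 0" "b z 0 = 0"
  using form_scale(1)[of 0 0 z] form_scale(2)[of z 0 0] by auto

lemma form_commute: "b x y = b y x"
  using symmetric by (auto simp: symmetric_form_def)

lemma card_scalar_gt_1: "CARD('a) > 1"
  using card_mono[OF finite subset_UNIV, of "{0, 1::'a}"] by simp

text \<open>For isotropic \<open>x\<close>, \<open>y\<close> in \<open>U\<close> with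
  \<open>b x y = 1\<close> this is the orthogonal complement in \<open>U\<close> of the hyperbolic
  plane they span. Applied to a totally isotropic \<open>L\<close> containing \<open>x\<close>, it
  gives a complement in \<open>L\<close> of the line of \<open>x\<close>, a model of the quotient by
  that line.\<close>

definition cut :: "'z \<Rightarrow> 'z \<Rightarrow> 'z set \<Rightarrow> 'z set" where
  "cut x y U = {u \<in> U. b x u = 0 \<and> b y u = 0}"

definition adjoin :: "'z \<Rightarrow> 'z set \<Rightarrow> 'z set" where
  "adjoin x L = {s c x + l | c l. l \<in> L}"

definition symplectic :: "'z set \<Rightarrow> bool" where
  "symplectic U \<longleftrightarrow> subspace U \<and> (\<forall>u\<in>U. b u u = 0) \<and> (\<forall>u\<in>U. (\<forall>v\<in>U. b u v = 0) \<longrightarrow> u = 0)"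

text \<open>Self-orthogonality inside \<open>V\<close>; being a subspace follows, as orthogonal
  complements are subspaces. The same predicate serves for symplectic \<open>V\<close> and for the
  nonalternating form on the whole space.\<close>

definition lagrangian :: "'z set \<Rightarrow> 'z set \<Rightarrow> bool" where
  "lagrangian V L \<longleftrightarrow> L \<subseteq> V \<and> (\<forall>v\<in>V. v \<in> L \<longleftrightarrow> (\<forall>l\<in>L. b v l = 0))"

lemma symplecticD:
  assumes "symplectic U"
  shows "subspace U" "\<And>u. u \<in> U \<Longrightarrow> b u u = 0" "\<And>u. u \<in> U \<Longrightarrow> (\<And>v. v \<in> U \<Longrightarrow> b u v = 0) \<Longrightarrow> u = 0"
  using assms by (auto simp: symplectic_def)

lemma subspace_cut: "subspace U \<Longrightarrow> subspace (cut x y U)"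
  by (auto simp: cut_def subspace_def)

lemma cut_subset: "cut x y U \<subseteq> U"
  by (auto simp: cut_def)

lemma subspace_lagrangian:
  assumes "subspace V" "lagrangian V L"
  shows "subspace L"
proof -
  have L: "L = {v \<in> V. \<forall>l\<in>L. b v l = 0}" using assms(2) by (auto simp: lagrangian_def)
  show ?thesis by (subst L) (use assms(1) in \<open>auto simp: subspace_def\<close>)
qed

lemma lagrangianD:
  assumes "lagrangian V L"
  shows "L \<subseteq> V" "\<And>x y. x \<in> L \<Longrightarrow> y \<in> L \<Longrightarrow> b x y = 0"
    "\<And>v. v \<in> V \<Longrightarrow> (\<And>l. l \<in> L \<Longrightarrow> b v l = 0) \<Longrightarrow> v \<in> L"
  using assms unfolding lagrangian_def by blast+

lemma adjoinI: "l \<in> L \<Longrightarrow> s c x + l \<in> adjoin x L"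
  unfolding adjoin_def by blast

lemma adjoinE:
  assumes "v \<in> adjoin x L"
  obtains c l where "v = s c x + l" "l \<in> L"
  using assms unfolding adjoin_def by blast

lemma adjoin_superset: "L \<subseteq> adjoin x L"
  using adjoinI[of _ L 0 x] by auto

lemma mem_adjoin_self: "subspace L \<Longrightarrow> x \<in> adjoin x L"
  using adjoinI[of 0 L 1 x] subspace_0 by auto

lemma subspace_adjoin:
  assumes "subspace L"
  shows "subspace (adjoin x L)"
  unfolding subspace_def
proof (intro conjI ballI allI)
  show "0 \<in> adjoin x L"
    using adjoin_superset subspace_0[OF assms] by blast
  fix v w c assume v: "v \<in> adjoin x L"
  then obtain c1 l1 where 1: "v = s c1 x + l1" "l1 \<in> L" by (auto simp: adjoin_def)
  have "s c v = s (c * c1) x + s c l1" by (simp add: 1 scale_right_distrib)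
  then show "s c v \<in> adjoin x L"
    using subspace_scale[OF assms 1(2)] unfolding adjoin_def by blast
  assume "w \<in> adjoin x L"
  then obtain c2 l2 where 2: "w = s c2 x + l2" "l2 \<in> L" by (auto simp: adjoin_def)
  have "v + w = s (c1 + c2) x + (l1 + l2)" by (simp add: 1 2 algebra_simps)
  then show "v + w \<in> adjoin x L"
    using subspace_add[OF assms 1(2) 2(2)] unfolding adjoin_def by blast
qed

lemma adjoin_subset: "subspace V \<Longrightarrow> x \<in> V \<Longrightarrow> L \<subseteq> V \<Longrightarrow> adjoin x L \<subseteq> V"
  by (auto simp: adjoin_def intro!: subspace_add subspace_scale)

lemma cut_adjoin:
  assumes "b x y = 1" "b x x = 0" "\<And>l. l \<in> L \<Longrightarrow> b x l = 0 \<and> b y l = 0"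
  shows "cut x y (adjoin x L) = L"
proof
  show "cut x y (adjoin x L) \<subseteq> L"
    using assms(1-3) by (auto simp: cut_def form_commute[of y x] elim!: adjoinE)
  show "L \<subseteq> cut x y (adjoin x L)"
    using assms(3) adjoin_superset by (auto simp: cut_def)
qed

text \<open>The coefficient of \<open>x\<close> is read off by pairing with \<open>y\<close>, and
  conversely; in characteristic 2 the plane component is removed by adding it.\<close>

lemma hyperbolic_projection:
  assumes "subspace U" "x \<in> U" "y \<in> U" "b x y = 1" "b x x = 0" "b y y = 0" "v \<in> U"
  shows "v + (s (b v y) x + s (b v x) y) \<in> cut x y U"
  using assms by (auto simp: cut_def form_commute[of y x] form_commute[of v] intro!: subspace_add subspace_scale)

lemma hyperbolic_decomposition:
  assumes "subspace U" "x \<in> U" "y \<in> U" "b x y = 1" "b x x = 0" "b y y = 0" "v \<in> U"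
  obtains w where "w \<in> cut x y U" "v = s (b v y) x + (s (b v x) y + w)"
proof
  show "v + (s (b v y) x + s (b v x) y) \<in> cut x y U" using hyperbolic_projection assms by blast
  show "v = s (b v y) x + (s (b v x) y + (v + (s (b v y) x + s (b v x) y)))"
    by (simp add: ac_simps)
qed

lemma symplectic_cut:
  assumes U: "symplectic U" and xy: "x \<in> U" "y \<in> U" "b x y = 1"
  shows "symplectic (cut x y U)"
  unfolding symplectic_def
proof (intro conjI ballI impI)
  note [simp] = symplecticD(2)[OF U]
  show "subspace (cut x y U)" using subspace_cut symplecticD(1)[OF U] .
  show "b u u = 0" if "u \<in> cut x y U" for u using that by (auto simp: cut_def)
  fix u assume u: "u \<in> cut x y U" "\<forall>v\<in>cut x y U. b u v = 0"
  show "u = 0"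
  proof (rule symplecticD(3)[OF U])
    show "u \<in> U" using u by (auto simp: cut_def)
    fix v assume v: "v \<in> U"
    obtain w where w: "w \<in> cut x y U" "v = s (b v y) x + (s (b v x) y + w)"
      using hyperbolic_decomposition[OF symplecticD(1)[OF U] xy _ _ v] xy by auto
    have "b u x = 0" "b u y = 0" "b u w = 0"
      using u w(1) by (auto simp: cut_def form_commute[of u])
    then show "b u v = 0" by (subst w(2)) simp
  qed
qed

text \<open>Translation along \<open>y\<close> moves \<open>b x\<close> through all scalars, so
  \<open>U\<close> is the product of a line and any one level set. Level 1 will count the hyperbolic
  partners of \<open>x\<close>, level 0 the complement of a unit vector.\<close>

lemma card_level_set:
  assumes U: "subspace U" and y: "y \<in> U" "b x y = 1"
  shows "card U = CARD('a) * card {u \<in> U. b x u = c}"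
proof -
  have "bij_betw (\<lambda>(d, u). s d y + u) (UNIV \<times> {u \<in> U. b x u = c}) U"
    by (rule bij_betw_byWitness[where f' = "\<lambda>v. (b x v + c, s (b x v + c) y + v)"])
      (use assms in \<open>auto intro!: subspace_add subspace_scale simp: scale_left_distrib ac_simps\<close>)
  then show ?thesis
    by (simp add: bij_betw_same_card[symmetric] card_cartesian_product)
qed

lemma card_cut:
  assumes "subspace U" "x \<in> U" "y \<in> U" "b x y = 1" "b x x = 0" "b y y = 0"
  shows "card U = CARD('a) ^ 2 * card (cut x y U)"
proof -
  have "bij_betw (\<lambda>((c, d), u). s c x + (s d y + u)) ((UNIV \<times> UNIV) \<times> cut x y U) U"
  proof (rule bij_betw_byWitness[where f' = "\<lambda>v. ((b v y, b v x), v + (s (b v y) x + s (b v x) y))"])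
    show "(\<lambda>v. ((b v y, b v x), v + (s (b v y) x + s (b v x) y))) ` U \<subseteq> (UNIV \<times> UNIV) \<times> cut x y U"
      using hyperbolic_projection[OF assms] by auto
  qed (use assms in \<open>auto intro!: subspace_add subspace_scale simp: cut_def form_commute ac_simps\<close>)
  then show ?thesis
    by (simp add: bij_betw_same_card[symmetric] card_cartesian_product power2_eq_square)
qed

lemma card_adjoin:
  assumes "b x y = 1" "subspace L" "\<And>l. l \<in> L \<Longrightarrow> b y l = 0"
  shows "card (adjoin x L) = CARD('a) * card L"
proof -
  have "bij_betw (\<lambda>(c, l). s c x + l) (UNIV \<times> L) (adjoin x L)"
    by (rule bij_betw_byWitness[where f' = "\<lambda>v. (b y v, v + s (b y v) x)"])
      (use assms in \<open>auto simp: adjoin_def form_commute[of y x] ac_simps\<close>)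
  then show ?thesis by (simp add: bij_betw_same_card[symmetric] card_cartesian_product)
qed

lemma symplectic_dual:
  assumes "symplectic U" "x \<in> U" "x \<noteq> 0"
  obtains y where "y \<in> U" "b x y = 1"
proof -
  obtain v where v: "v \<in> U" "b x v \<noteq> 0"
    using symplecticD(3)[OF assms(1,2)] assms(3) by blast
  show thesis
    by (rule that[of "s (1 / b x v) v"]) (use v in \<open>auto intro!: subspace_scale symplecticD(1)[OF assms(1)]\<close>)
qed

lemma adjoin_cut:
  assumes L: "subspace L" "x \<in> L" "b x y = 1" "\<And>l. l \<in> L \<Longrightarrow> b x l = 0"
  shows "adjoin x (cut x y L) = L"
proof
  show "adjoin x (cut x y L) \<subseteq> L"
    using L by (auto simp: adjoin_def cut_def intro!: subspace_add subspace_scale)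
  show "L \<subseteq> adjoin x (cut x y L)"
  proof
    fix l assume l: "l \<in> L"
    have "l + s (b y l) x \<in> cut x y L"
      using L l by (auto simp: cut_def form_commute[of y x] intro!: subspace_add subspace_scale)
    moreover have "l = s (b y l) x + (l + s (b y l) x)" by (simp add: ac_simps)
    ultimately show "l \<in> adjoin x (cut x y L)" unfolding adjoin_def by blast
  qed
qed

text \<open>Symplectic reduction of \<open>L\<close> by the line of \<open>x\<close>. A vector of
  the cut is orthogonal to \<open>x\<close> already, so orthogonality to the reduced
  \<open>L\<close> amounts to orthogonality to \<open>L\<close>.\<close>

lemma lagrangian_cut:
  assumes V: "symplectic V" and L: "lagrangian V L" and xy: "x \<in> L" "y \<in> V" "b x y = 1"
  shows "lagrangian (cut x y V) (cut x y L)" "adjoin x (cut x y L) = L"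
proof -
  have sL: "subspace L" using subspace_lagrangian[OF symplecticD(1)[OF V] L] .
  show L_eq: "adjoin x (cut x y L) = L"
    by (rule adjoin_cut[OF sL xy(1,3) lagrangianD(2)[OF L xy(1)]])
  show "lagrangian (cut x y V) (cut x y L)"
    unfolding lagrangian_def
  proof (intro conjI ballI)
    show "cut x y L \<subseteq> cut x y V" using lagrangianD(1)[OF L] by (auto simp: cut_def)
    fix v assume v: "v \<in> cut x y V"
    show "v \<in> cut x y L \<longleftrightarrow> (\<forall>l\<in>cut x y L. b v l = 0)"
    proof
      assume "v \<in> cut x y L" then show "\<forall>l\<in>cut x y L. b v l = 0"
        using lagrangianD(2)[OF L] by (auto simp: cut_def)
    next
      assume orth: "\<forall>l\<in>cut x y L. b v l = 0"
      have "v \<in> L"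
      proof (rule lagrangianD(3)[OF L])
        show "v \<in> V" using v by (auto simp: cut_def)
        fix l assume "l \<in> L"
        then obtain c m where "l = s c x + m" "m \<in> cut x y L" using L_eq by (blast elim: adjoinE)
        then show "b v l = 0" using orth v by (auto simp: cut_def form_commute[of v x])
      qed
      then show "v \<in> cut x y L" using v by (auto simp: cut_def)
    qed
  qed
qed

text \<open>The inverse of reduction. A vector orthogonal to \<open>adjoin x L\<close> has no
  \<open>y\<close> component, because that coefficient is its pairing with \<open>x\<close>; beside
  a multiple of \<open>x\<close> there remains a vector of the cut orthogonal to
  \<open>L\<close>.\<close>

lemma lagrangian_adjoin:
  assumes V: "symplectic V" and xy: "x \<in> V" "y \<in> V" "b x y = 1" and L: "lagrangian (cut x y V) L"
  shows "lagrangian V (adjoin x L)"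
  unfolding lagrangian_def
proof (intro conjI ballI)
  note xx = symplecticD(2)[OF V xy(1)] and yy = symplecticD(2)[OF V xy(2)]
  have sL: "subspace L" using subspace_lagrangian[OF subspace_cut[OF symplecticD(1)[OF V]] L] .
  have LV: "L \<subseteq> cut x y V" using lagrangianD(1)[OF L] .
  then have Lx: "b x l = 0" "b l x = 0" if "l \<in> L" for l
    using subsetD[OF _ that, of "cut x y V"] form_commute[of l x] by (auto simp: cut_def)
  show sub: "adjoin x L \<subseteq> V"
    using adjoin_subset[OF symplecticD(1)[OF V] xy(1)] LV cut_subset by blast
  fix v assume v: "v \<in> V"
  show "v \<in> adjoin x L \<longleftrightarrow> (\<forall>l\<in>adjoin x L. b v l = 0)"
  proof
    assume "v \<in> adjoin x L"
    then obtain c l where v_eq: "v = s c x + l" and l: "l \<in> L" by (rule adjoinE)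
    show "\<forall>m\<in>adjoin x L. b v m = 0"
    proof
      fix m assume "m \<in> adjoin x L"
      then obtain d k where "m = s d x + k" "k \<in> L" by (rule adjoinE)
      then show "b v m = 0" by (simp add: v_eq Lx l xx lagrangianD(2)[OF L])
    qed
  next
    assume orth: "\<forall>l\<in>adjoin x L. b v l = 0"
    obtain w where w: "w \<in> cut x y V" "v = s (b v y) x + (s (b v x) y + w)"
      using hyperbolic_decomposition[OF symplecticD(1)[OF V] xy xx yy v] .
    have vx: "b v x = 0" using orth mem_adjoin_self[OF sL] by blast
    have v_eq: "v = s (b v y) x + w" using w(2) by (simp add: vx)
    have "w \<in> L"
    proof (rule lagrangianD(3)[OF L w(1)])
      fix l assume l: "l \<in> L"
      then have "b v l = 0" using orth adjoin_superset by blast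
      moreover have "b x l = 0" using l LV by (auto simp: cut_def)
      ultimately show "b w l = 0" by (subst (asm) v_eq) simp
    qed
    then show "v \<in> adjoin x L" using v_eq unfolding adjoin_def by blast
  qed
qed

lemma card_cut_less:
  assumes "x \<in> U" "b x y = 1"
  shows "card (cut x y U) < card U"
proof (rule psubset_card_mono)
  have "x \<notin> cut x y U" using assms by (auto simp: cut_def form_commute[of y x])
  then show "cut x y U \<subset> U" using cut_subset[of x y U] assms(1) by blast
qed simp

text \<open>A nonzero vector of a symplectic space has a hyperbolic partner, so every space other
  than {0} loses a plane and becomes smaller.\<close>

lemma symplectic_induct [consumes 1, case_names zero cut]:
  assumes "symplectic U"
    and "P {0}"
    and "\<And>U x y. symplectic U \<Longrightarrow> x \<in> U \<Longrightarrow> y \<in> U \<Longrightarrow> b x y = 1 \<Longrightarrow> P (cut x y U) \<Longrightarrow> P U"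
  shows "P U"
  using assms(1)
proof (induction "card U" arbitrary: U rule: less_induct)
  case less
  show ?case
  proof (cases "U = {0}")
    case False
    have U: "subspace U" using symplecticD(1)[OF less.prems] .
    obtain x where x: "x \<in> U" "x \<noteq> 0" using False subspace_0[OF U] by blast
    obtain y where y: "y \<in> U" "b x y = 1" using symplectic_dual[OF less.prems x] .
    show ?thesis
      by (rule assms(3)[OF less.prems x(1) y
            less.hyps[OF card_cut_less[OF x(1) y(2)] symplectic_cut[OF less.prems x(1) y]]])
  qed (use assms(2) in simp)
qed

lemma card_symplectic:
  assumes "symplectic U"
  shows "\<exists>m. card U = CARD('a) ^ (2 * m)"
  using assms
proof (induction rule: symplectic_induct)
  case zero then show ?case by (auto intro!: exI[of _ 0])
next
  case (cut U x y)
  then obtain m where "card (cut x y U) = CARD('a) ^ (2 * m)" by blast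
  moreover have "card U = CARD('a) ^ 2 * card (cut x y U)"
    using card_cut cut symplecticD[OF cut(1)] by blast
  ultimately show ?case by (auto intro!: exI[of _ "Suc m"] simp: power2_eq_square)
qed

text \<open>Each reduction divides the size of \<open>L\<close> by q and that of \<open>V\<close> by
  the square of q. The process ends with both trivial: if \<open>L\<close> is {0}, all of
  \<open>V\<close> is orthogonal to it and hence contained in it.\<close>

lemma card_lagrangian:
  assumes "symplectic V" "lagrangian V L"
  shows "card L ^ 2 = card V"
  using assms
proof (induction "card V" arbitrary: V L rule: less_induct)
  case less
  note V = less.prems(1) and L = less.prems(2)
  have sV: "subspace V" and sL: "subspace L"
    using symplecticD(1)[OF V] subspace_lagrangian L by auto
  show ?case
  proof (cases "L = {0}")
    case True
    then have "V = {0}" using lagrangianD[OF L] subspace_0[OF sV] by fastforce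
    then show ?thesis by (simp add: True)
  next
    case False
    then obtain x where x: "x \<in> L" "x \<noteq> 0" using subspace_0[OF sL] by blast
    then have xV: "x \<in> V" using lagrangianD(1)[OF L] by blast
    obtain y where y: "y \<in> V" "b x y = 1" using symplectic_dual[OF V xV x(2)] .
    have cV: "card V = CARD('a) ^ 2 * card (cut x y V)"
      using card_cut[OF sV xV y] symplecticD(2)[OF V] xV y by blast
    have "card (cut x y L) ^ 2 = card (cut x y V)"
      by (rule less.hyps[OF card_cut_less[OF xV y(2)] symplectic_cut[OF V xV y] lagrangian_cut(1)[OF V L x(1) y]])
    moreover have "card L = CARD('a) * card (cut x y L)"
      using card_adjoin[OF y(2) subspace_cut[OF sL], of x y] lagrangian_cut(2)[OF V L x(1) y]
      by (simp add: cut_def)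
    ultimately show ?thesis by (simp add: cV power_mult_distrib)
  qed
qed

subsection \<open>Orthogonal sums of two symplectic spaces\<close>

definition osum :: "'z set \<Rightarrow> 'z set \<Rightarrow> 'z set" where
  "osum U U' = {u + u' | u u'. u \<in> U \<and> u' \<in> U'}"

definition symplectic_pair :: "'z set \<Rightarrow> 'z set \<Rightarrow> bool" where
  "symplectic_pair U U' \<longleftrightarrow> symplectic U \<and> symplectic U' \<and> (\<forall>u\<in>U. \<forall>u'\<in>U'. b u u' = 0)"

lemma osumI: "u \<in> U \<Longrightarrow> u' \<in> U' \<Longrightarrow> u + u' \<in> osum U U'"
  by (auto simp: osum_def)

lemma osumE:
  assumes "v \<in> osum U U'"
  obtains u u' where "v = u + u'" "u \<in> U" "u' \<in> U'"
  using assms by (auto simp: osum_def)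

lemma osum_commute: "osum U U' = osum U' U"
  by (auto simp: osum_def) (metis add.commute)+

lemma symplectic_pairD:
  assumes "symplectic_pair U U'"
  shows "symplectic U" "symplectic U'"
    "\<And>u u'. u \<in> U \<Longrightarrow> u' \<in> U' \<Longrightarrow> b u u' = 0" "\<And>u u'. u \<in> U \<Longrightarrow> u' \<in> U' \<Longrightarrow> b u' u = 0"
  using assms by (auto simp: symplectic_pair_def form_commute)

lemma symplectic_pair_commute: "symplectic_pair U U' \<Longrightarrow> symplectic_pair U' U"
  unfolding symplectic_pair_def by (metis form_commute)

lemma subspace_osum:
  assumes "subspace U" "subspace U'"
  shows "subspace (osum U U')"
  using subspace_sums[OF assms] by (simp add: osum_def)

lemma osum_superset:
  assumes "symplectic_pair U U'"
  shows "U \<subseteq> osum U U'" "U' \<subseteq> osum U U'"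
  using osumI[of _ U 0 U'] osumI[of 0 U _ U'] symplectic_pairD(1,2)[OF assms, THEN symplecticD(1), THEN subspace_0]
  by auto

lemma symplectic_osum:
  assumes "symplectic_pair U U'"
  shows "symplectic (osum U U')"
  unfolding symplectic_def
proof (intro conjI ballI impI)
  note p = symplectic_pairD[OF assms]
  show "subspace (osum U U')" by (intro subspace_osum symplecticD(1) p)
  fix v assume "v \<in> osum U U'"
  then obtain u u' where v: "v = u + u'" "u \<in> U" "u' \<in> U'" by (rule osumE)
  show "b v v = 0" using v p symplecticD(2)[OF p(1)] symplecticD(2)[OF p(2)] by simp
  assume 0: "\<forall>w\<in>osum U U'. b v w = 0"
  have "u = 0"
  proof (rule symplecticD(3)[OF p(1) v(2)])
    fix w assume "w \<in> U"
    then have "b v w = 0" using 0 osum_superset[OF assms] by blast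
    then show "b u w = 0" using p(4)[OF \<open>w \<in> U\<close> v(3)] by (simp add: v)
  qed
  moreover have "u' = 0"
  proof (rule symplecticD(3)[OF p(2) v(3)])
    fix w assume "w \<in> U'"
    then have "b v w = 0" using 0 osum_superset[OF assms] by blast
    then show "b u' w = 0" using p(3)[OF v(2) \<open>w \<in> U'\<close>] by (simp add: v)
  qed
  ultimately show "v = 0" by (simp add: v)
qed

lemma symplectic_pair_Int:
  assumes "symplectic_pair U U'"
  shows "v \<in> U \<Longrightarrow> v \<in> U' \<Longrightarrow> v = 0"
  using symplecticD(3)[OF symplectic_pairD(1)[OF assms]] symplectic_pairD(4)[OF assms] by blast

lemma symplectic_pair_cut:
  assumes "symplectic_pair U U'" "x \<in> U" "y \<in> U" "b x y = 1"
  shows "symplectic_pair (cut x y U) U'"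
  using assms symplectic_cut[of U x y] by (auto simp: symplectic_pair_def cut_def)

lemma cut_osum:
  assumes "symplectic_pair U U'" "x \<in> U" "y \<in> U"
  shows "cut x y (osum U U') = osum (cut x y U) U'"
  using symplectic_pairD(3)[OF assms(1)] assms(2,3) unfolding cut_def osum_def by fastforce

text \<open>Reduction along a vector of \<open>L\<close> lying in the summand \<open>U\<close>, with
  its partner in \<open>U\<close> too. Both vectors are orthogonal to \<open>U'\<close>, so only the
  part of \<open>L\<close> in \<open>U\<close> shrinks, by one dimension.\<close>

lemma lagrangian_cut_left:
  assumes p: "symplectic_pair U U'" and L: "lagrangian (osum U U') L"
    and xy: "x \<in> L" "x \<in> U" "y \<in> U" "b x y = 1"
  shows "lagrangian (osum (cut x y U) U') (cut x y L)"
    and "adjoin x (cut x y L) = L"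
    and "card (L \<inter> U) = CARD('a) * card (cut x y L \<inter> cut x y U)"
    and "cut x y L \<inter> U' = L \<inter> U'"
proof -
  have y: "y \<in> osum U U'" using xy osum_superset[OF p] by blast
  show "lagrangian (osum (cut x y U) U') (cut x y L)" "adjoin x (cut x y L) = L"
    using lagrangian_cut[OF symplectic_osum[OF p] L xy(1) y xy(4)] by (simp_all add: cut_osum[OF p xy(2,3)])
  have sU: "subspace U" using symplecticD(1)[OF symplectic_pairD(1)[OF p]] .
  have sL: "subspace L" using subspace_lagrangian[OF symplecticD(1)[OF symplectic_osum[OF p]] L] .
  have sI: "subspace (L \<inter> U)" using sU sL by (rule subspace_inter[rotated])
  have "adjoin x (cut x y (L \<inter> U)) = L \<inter> U"
    by (rule adjoin_cut[OF sI _ xy(4)]) (use xy lagrangianD(2)[OF L] in auto)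
  moreover have "card (adjoin x (cut x y (L \<inter> U))) = CARD('a) * card (cut x y (L \<inter> U))"
    by (rule card_adjoin[OF xy(4) subspace_cut[OF sI]]) (simp add: cut_def)
  moreover have "cut x y (L \<inter> U) = cut x y L \<inter> cut x y U" by (auto simp: cut_def)
  ultimately show "card (L \<inter> U) = CARD('a) * card (cut x y L \<inter> cut x y U)" by simp
  show "cut x y L \<inter> U' = L \<inter> U'"
    using symplectic_pairD(3)[OF p] xy by (auto simp: cut_def)
qed

lemma inj_on_osum:
  assumes "symplectic_pair U U'"
  shows "inj_on (\<lambda>(u, u'). u + u') (U \<times> U')"
proof (rule inj_onI, clarify)
  fix u u' v v' assume uv: "u \<in> U" "u' \<in> U'" "v \<in> U" "v' \<in> U'" and eq: "u + u' = v + v'"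
  note sU = symplectic_pairD(1,2)[OF assms, THEN symplecticD(1)]
  have "u + v = (u + u') + (u' + v)" by (simp add: ac_simps)
  also have "\<dots> = (v + v') + (u' + v)" by (simp only: eq)
  also have "\<dots> = u' + v'" by (simp add: ac_simps)
  finally have uvv: "u + v = u' + v'" .
  have "u + v \<in> U" "u' + v' \<in> U'" using sU uv subspace_add by auto
  then have "u + v = 0" using symplectic_pair_Int[OF assms] uvv by metis
  then show "u = v \<and> u' = v'" using uvv by (metis vector_double(1) add_right_cancel)
qed

lemma card_osum:
  assumes "symplectic_pair U U'"
  shows "card (osum U U') = card U * card U'"
proof -
  have "osum U U' = (\<lambda>(u, u'). u + u') ` (U \<times> U')" by (auto simp: osum_def)
  then show ?thesis using card_image[OF inj_on_osum[OF assms]] by (simp add: card_cartesian_product)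
qed

text \<open>When \<open>L\<close> meets both summands trivially, both projections are injective on
  \<open>L\<close>, so its size is at most that of \<open>U\<close> and of \<open>U'\<close>. The
  square of its size is the product of the two, which forces equality: \<open>L\<close> is the graph
  of a bijection.\<close>

lemma lagrangian_graph:
  assumes p: "symplectic_pair U U'" and L: "lagrangian (osum U U') L"
    and I: "L \<inter> U = {0}" "L \<inter> U' = {0}"
  shows "card U = card U'" and "\<And>x. x \<in> U \<Longrightarrow> \<exists>!x'. x' \<in> U' \<and> x + x' \<in> L"
proof -
  \<comment> \<open>\<open>R\<close> is \<open>L\<close> read as a relation between \<open>U\<close>
    and \<open>U'\<close>.\<close>
  define R where "R = {(u, u'). u \<in> U \<and> u' \<in> U' \<and> u + u' \<in> L}"
  have sL: "subspace L" using subspace_lagrangian[OF symplecticD(1)[OF symplectic_osum[OF p]] L] .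
  note sU = symplectic_pairD(1,2)[OF p, THEN symplecticD(1)]
  have "L = (\<lambda>(u, u'). u + u') ` R"
    using lagrangianD(1)[OF L] by (force simp: R_def osum_def)
  moreover have "inj_on (\<lambda>(u, u'). u + u') R"
    by (rule inj_on_subset[OF inj_on_osum[OF p]]) (auto simp: R_def)
  ultimately have cR: "card R = card L" by (simp add: card_image)
  have uniq: "u' = v'" if "u \<in> U" "u' \<in> U'" "v' \<in> U'" "u + u' \<in> L" "u + v' \<in> L" for u u' v'
  proof -
    have "(u + u') + (u + v') \<in> L" using subspace_add[OF sL] that by blast
    then have "u' + v' \<in> L" by (simp add: ac_simps)
    then have "u' + v' = 0" using subspace_add[OF sU(2)] that I by blast
    then show ?thesis by (metis vector_double(1) add_left_cancel)
  qed
  have i1: "inj_on fst R" using uniq by (auto simp: inj_on_def R_def)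
  have uniq': "u = v" if "u \<in> U" "v \<in> U" "v' \<in> U'" "u + v' \<in> L" "v + v' \<in> L" for u v v'
  proof -
    have "(u + v') + (v + v') \<in> L" using subspace_add[OF sL] that by blast
    then have "u + v \<in> L" by (simp add: ac_simps)
    then have "u + v = 0" using subspace_add[OF sU(1)] that I by blast
    then show ?thesis by (metis vector_double(1) add_left_cancel)
  qed
  have i2: "inj_on snd R" using uniq' by (auto simp: inj_on_def R_def)
  have R1: "fst ` R \<subseteq> U" and R2: "snd ` R \<subseteq> U'" by (auto simp: R_def)
  have le: "card L \<le> card U" "card L \<le> card U'"
    using card_inj_on_le[OF i1 R1] card_inj_on_le[OF i2 R2] cR by auto
  have sq: "card L * card L = card U * card U'"
    using card_lagrangian[OF symplectic_osum[OF p] L] by (simp add: card_osum[OF p] power2_eq_square)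
  have pos: "card L > 0" using subspace_0[OF sL] by (auto simp: card_gt_0_iff)
  have "card U \<le> card L"
  proof (rule ccontr)
    assume "\<not> card U \<le> card L"
    then have "card L * card L < card U * card U'" using le pos by (intro mult_less_le_imp_less) auto
    then show False using sq by simp
  qed
  then have eq: "card L = card U" using le by simp
  have "card U > 0" "card U * card U = card U * card U'" using sq pos by (simp_all only: eq)
  then show "card U = card U'" by (simp only: nat_mult_eq_cancel1)
  have "fst ` R = U"
    by (rule card_subset_eq[OF _ R1]) (use card_image[OF i1] cR eq in auto)
  then show "\<exists>!x'. x' \<in> U' \<and> x + x' \<in> L" if x: "x \<in> U" for x
  proof -
    obtain x' where "(x, x') \<in> R" using x \<open>fst ` R = U\<close> by force
    then show ?thesis using uniq[OF x] unfolding R_def by blast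
  qed
qed

text \<open>Splitting off vectors of \<open>L\<close> that lie in either summand leaves a graph,
  whose two sides have the same dimension 2M. Hence \<open>k\<close> determines
  \<open>k'\<close>.\<close>

lemma lagrangian_shape:
  assumes "symplectic_pair U U'" "lagrangian (osum U U') L"
  shows "\<exists>k k' M. card (L \<inter> U) = CARD('a) ^ k \<and> card (L \<inter> U') = CARD('a) ^ k' \<and>
    card U = CARD('a) ^ (2 * (k + M)) \<and> card U' = CARD('a) ^ (2 * (k' + M))"
  using assms
proof (induction "card U + card U'" arbitrary: U U' L rule: less_induct)
  case less
  note p = less.prems(1) and L = less.prems(2)
  have sL: "subspace L" using subspace_lagrangian[OF symplecticD(1)[OF symplectic_osum[OF p]] L] .
  note sU = symplectic_pairD(1,2)[OF p, THEN symplecticD(1)]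
  consider (left) "L \<inter> U \<noteq> {0}" | (right) "L \<inter> U' \<noteq> {0}" | (graph) "L \<inter> U = {0}" "L \<inter> U' = {0}"
    by blast
  then show ?case
  proof cases
    case left
    then obtain x where x: "x \<in> L" "x \<in> U" "x \<noteq> 0" using subspace_0[OF sL] subspace_0[OF sU(1)] by blast
    obtain y where y: "y \<in> U" "b x y = 1" using symplectic_dual[OF symplectic_pairD(1)[OF p] x(2,3)] .
    have "card (cut x y U) + card U' < card U + card U'" using card_cut_less[OF x(2) y(2)] by simp
    from less.hyps[OF this symplectic_pair_cut[OF p x(2) y] lagrangian_cut_left(1)[OF p L x(1,2) y]]
    obtain k k' M where IH: "card (cut x y L \<inter> cut x y U) = CARD('a) ^ k"
      "card (cut x y L \<inter> U') = CARD('a) ^ k'"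
      "card (cut x y U) = CARD('a) ^ (2 * (k + M))" "card U' = CARD('a) ^ (2 * (k' + M))" by blast
    have "card U = CARD('a) ^ 2 * card (cut x y U)"
      using card_cut[OF sU(1) x(2) y] symplecticD(2)[OF symplectic_pairD(1)[OF p]] x y by blast
    then show ?thesis
      using IH lagrangian_cut_left(3,4)[OF p L x(1,2) y]
      by (intro exI[of _ "Suc k"] exI[of _ k'] exI[of _ M]) (simp add: power2_eq_square)
  next
    case right
    note p' = symplectic_pair_commute[OF p]
    have L': "lagrangian (osum U' U) L" using L by (simp add: osum_commute)
    obtain x where x: "x \<in> L" "x \<in> U'" "x \<noteq> 0"
      using right subspace_0[OF sL] subspace_0[OF sU(2)] by blast
    obtain y where y: "y \<in> U'" "b x y = 1" using symplectic_dual[OF symplectic_pairD(2)[OF p] x(2,3)] .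
    have lt: "card U + card (cut x y U') < card U + card U'" using card_cut_less[OF x(2) y(2)] by simp
    have L1: "lagrangian (osum U (cut x y U')) (cut x y L)"
      using lagrangian_cut_left(1)[OF p' L' x(1,2) y] by (simp add: osum_commute)
    from less.hyps[OF lt symplectic_pair_commute[OF symplectic_pair_cut[OF p' x(2) y]] L1]
    obtain k k' M where IH: "card (cut x y L \<inter> U) = CARD('a) ^ k"
      "card (cut x y L \<inter> cut x y U') = CARD('a) ^ k'"
      "card U = CARD('a) ^ (2 * (k + M))" "card (cut x y U') = CARD('a) ^ (2 * (k' + M))" by blast
    have "card U' = CARD('a) ^ 2 * card (cut x y U')"
      using card_cut[OF sU(2) x(2) y] symplecticD(2)[OF symplectic_pairD(2)[OF p]] x y by blast
    then show ?thesis
      using IH lagrangian_cut_left(3,4)[OF p' L' x(1,2) y]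
      by (intro exI[of _ k] exI[of _ "Suc k'"] exI[of _ M]) (simp add: power2_eq_square)
  next
    case graph
    obtain M where "card U = CARD('a) ^ (2 * M)"
      using card_symplectic[OF symplectic_pairD(1)[OF p]] by blast
    then show ?thesis
      using graph lagrangian_graph(1)[OF p L graph]
      by (intro exI[of _ 0] exI[of _ M]) simp
  qed
qed

subsection \<open>Frames\<close>

text \<open>A symplectic basis as a list of hyperbolic pairs, each one chosen in the orthogonal
  complement of the earlier ones. The empty list is accepted only for {0}, which makes the list
  span.\<close>

fun frame :: "'z set \<Rightarrow> ('z \<times> 'z) list \<Rightarrow> bool" where
  "frame U [] \<longleftrightarrow> U = {0}"
| "frame U (p # B) \<longleftrightarrow> fst p \<in> U \<and> snd p \<in> U \<and> b (fst p) (snd p) = 1 \<and> frame (cut (fst p) (snd p) U) B"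

text \<open>Two frames determine for each admissible shape one Lagrangian of the orthogonal sum: it contains
the first vectors of the first \<open>k\<close> (resp. \<open>k'\<close>) pairs, and on the remaining pairs it is the graph of
the isometry matching the two frames. In characteristic 2 no sign change is needed.\<close>

fun frame_lagrangian :: "nat \<Rightarrow> nat \<Rightarrow> ('z \<times> 'z) list \<Rightarrow> ('z \<times> 'z) list \<Rightarrow> 'z set" where
  "frame_lagrangian (Suc k) k' (p # B) B' = adjoin (fst p) (frame_lagrangian k k' B B')"
| "frame_lagrangian 0 (Suc k') B (p' # B') = adjoin (fst p') (frame_lagrangian 0 k' B B')"
| "frame_lagrangian 0 0 (p # B) (p' # B') = adjoin (fst p + fst p') (adjoin (snd p + snd p') (frame_lagrangian 0 0 B B'))"
| "frame_lagrangian _ _ _ _ = {0}"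

definition adapted :: "nat \<Rightarrow> nat \<Rightarrow> 'z set \<Rightarrow> 'z set \<Rightarrow> 'z set \<Rightarrow> (('z \<times> 'z) list \<times> ('z \<times> 'z) list) set" where
  "adapted k k' U U' L = {(B, B'). frame U B \<and> frame U' B' \<and> frame_lagrangian k k' B B' = L}"

definition hyperbolic_pairs :: "'z set \<Rightarrow> 'z set \<Rightarrow> ('z \<times> 'z) set" where
  "hyperbolic_pairs A U = {(x, y). x \<in> A \<and> y \<in> U \<and> b x y = 1}"

lemma frame_length:
  assumes "symplectic U" "frame U B"
  shows "card U = CARD('a) ^ (2 * length B)"
  using assms
proof (induction B arbitrary: U)
  case (Cons p B)
  let ?U = "cut (fst p) (snd p) U"
  note U = Cons.prems(1)
  have p: "fst p \<in> U" "snd p \<in> U" "b (fst p) (snd p) = 1" "frame ?U B" using Cons.prems(2) by auto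
  have "card ?U = CARD('a) ^ (2 * length B)"
    using Cons.IH[OF symplectic_cut[OF U p(1-3)] p(4)] .
  moreover have "card U = CARD('a) ^ 2 * card ?U"
    using card_cut[OF symplecticD(1)[OF U] p(1-3)] symplecticD(2)[OF U] p by blast
  ultimately show ?case by (simp add: power2_eq_square)
qed simp

lemma frame_length_eq:
  assumes "symplectic U" "frame U B" "card U = CARD('a) ^ (2 * m)"
  shows "length B = m"
  using frame_length[OF assms(1,2)] assms(3) card_scalar_gt_1 by simp

lemma frame_subset: "frame U B \<Longrightarrow> p \<in> set B \<Longrightarrow> fst p \<in> U \<and> snd p \<in> U"
proof (induction B arbitrary: U)
  case (Cons p' B)
  then show ?case using cut_subset by fastforce
qed simp

lemma finite_frames:
  assumes "symplectic U"
  shows "finite {B. frame U B}"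
proof -
  obtain m where m: "card U = CARD('a) ^ (2 * m)" using card_symplectic[OF assms] by blast
  have "finite {B :: ('z \<times> 'z) list. set B \<subseteq> UNIV \<and> length B = m}"
    by (rule finite_lists_length_eq) (rule finite_Prod_UNIV[OF finite_UNIV_vec finite_UNIV_vec])
  then show ?thesis
    by (rule rev_finite_subset) (use frame_length_eq[OF assms _ m] in auto)
qed

lemma finite_adapted:
  assumes "symplectic_pair U U'"
  shows "finite (adapted k k' U U' L)"
  by (rule finite_subset[of _ "{B. frame U B} \<times> {B. frame U' B}"])
    (auto simp: adapted_def finite_frames symplectic_pairD[OF assms])

lemma lagrangian_zero: "lagrangian {0} {0}"
  by (auto simp: lagrangian_def)

lemma frame_lagrangian_commute_0: "frame_lagrangian 0 0 B B' = frame_lagrangian 0 0 B' B"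
proof (induction B arbitrary: B')
  case Nil then show ?case by (cases B') auto
next
  case (Cons p B) then show ?case by (cases B') (auto simp: add.commute)
qed

text \<open>The equations of \<open>frame_lagrangian\<close> consume the first frame before the
  second, so the symmetry is stated where one of the two numbers is 0; that is what exchanging the
  summands will require.\<close>

lemma frame_lagrangian_commute: "frame_lagrangian 0 k B B' = frame_lagrangian k 0 B' B"
proof (induction k arbitrary: B')
  case 0 then show ?case by (rule frame_lagrangian_commute_0)
next
  case (Suc k) then show ?case by (cases B') auto
qed

text \<open>Pairing with \<open>x'\<close> and \<open>y'\<close> reads off the coefficients of the
  two graph vectors, and a vector of \<open>U\<close> is orthogonal to both. What remains is a
  vector of \<open>L\<close> whose component in \<open>U'\<close> also lies in \<open>U\<close>, so
  it vanishes.\<close>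

lemma adjoin_graph_Int:
  assumes p: "symplectic_pair U U'"
    and xy: "x \<in> U" "y \<in> U" "b x y = 1" and xy': "x' \<in> U'" "y' \<in> U'" "b x' y' = 1"
    and L: "L \<subseteq> osum (cut x y U) (cut x' y' U')" "L \<inter> cut x y U = {0}"
  shows "adjoin (x + x') (adjoin (y + y') L) \<inter> U = {0}"
proof -
  note sU = symplectic_pairD(1,2)[OF p, THEN symplecticD(1)]
  note alt = symplectic_pairD(1,2)[OF p, THEN symplecticD(2)]
  have "v = 0" if v: "v \<in> adjoin (x + x') (adjoin (y + y') L)" "v \<in> U" for v
  proof -
    obtain c d l where eq: "v = s c (x + x') + (s d (y + y') + l)" and l: "l \<in> L"
      using v(1) by (metis adjoinE)
    obtain u u' where l_eq: "l = u + u'" and u: "u \<in> cut x y U" "u' \<in> cut x' y' U'"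
      using subsetD[OF L(1) l] by (rule osumE)
    have uu: "u \<in> U" "u' \<in> U'" "b x u = 0" "b y u = 0" "b x' u' = 0" "b y' u' = 0"
      using u by (auto simp: cut_def)
    note 0 = symplectic_pairD(3,4)[OF p]
    have "b v x' = d"
      using 0 xy xy' uu alt by (simp add: eq l_eq form_commute[of y' x'] form_commute[of u' x'])
    then have d: "d = 0" using 0 v(2) xy' by simp
    have "b v y' = c"
      using 0 xy xy' uu alt by (simp add: eq l_eq form_commute[of u' y'])
    then have c: "c = 0" using 0 v(2) xy' by simp
    have "v = l" by (simp add: eq c d)
    have "u + v \<in> U" using subspace_add[OF sU(1) uu(1) v(2)] .
    then have "u' \<in> U" by (simp add: \<open>v = l\<close> l_eq)
    then have "u' = 0" using symplectic_pair_Int[OF p _ uu(2)] by simp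
    then show "v = 0" using L(2) l u(1) \<open>v = l\<close> l_eq by auto
  qed
  moreover have "0 \<in> L" using L(2) by blast
  then have "0 \<in> adjoin (x + x') (adjoin (y + y') L)" using adjoin_superset by blast
  ultimately show ?thesis using subspace_0[OF sU(1)] by blast
qed

text \<open>A graph contributes the orthogonal vectors \<open>x + x'\<close> and
  \<open>y + y'\<close>, with partners \<open>y\<close> and \<open>x'\<close>. The four
  orthogonality conditions of the two cuts combine to orthogonality to each of \<open>x\<close>,
  \<open>y\<close>, \<open>x'\<close>, \<open>y'\<close>.\<close>

lemma cut_graph:
  assumes p: "symplectic_pair U U'"
    and xy: "x \<in> U" "y \<in> U" "x' \<in> U'" "y' \<in> U'"
  shows "cut (y + y') x' (cut (x + x') y (osum U U')) = osum (cut x y U) (cut x' y' U')"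
proof -
  note 0 = symplectic_pairD(3,4)[OF p]
  have "cut (y + y') x' (cut (x + x') y (osum U U')) = cut x' y' (cut x y (osum U U'))"
    by (auto simp: cut_def)
  also have "\<dots> = cut x' y' (osum U' (cut x y U))"
    by (simp add: cut_osum[OF p xy(1,2)] osum_commute)
  also have "\<dots> = osum (cut x' y' U') (cut x y U)"
  proof -
    have "b u' u = 0" if "u' \<in> U'" "u \<in> cut x y U" for u u'
      using 0 that by (auto simp: cut_def)
    then show ?thesis
      using xy unfolding cut_def[of x' y'] osum_def by fastforce
  qed
  finally show ?thesis by (simp add: osum_commute)
qed

lemma card_eq_1_subspace: "subspace A \<Longrightarrow> card A = 1 \<longleftrightarrow> A = {0}"
  using subspace_0 by (auto simp: card_1_singleton_iff)

text \<open>The common surplus \<open>M\<close> of the two lengths is the number of pairs left for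
  the graph part, so neither frame runs out early. Each equation of the recursion inverts one
  reduction, the graph equation two of them.\<close>

lemma lagrangian_frame_lagrangian:
  assumes "symplectic_pair U U'" "frame U B" "frame U' B'" "length B = k + M" "length B' = k' + M"
  shows "lagrangian (osum U U') (frame_lagrangian k k' B B') \<and> card (frame_lagrangian k k' B B' \<inter> U) = CARD('a) ^ k
    \<and> card (frame_lagrangian k k' B B' \<inter> U') = CARD('a) ^ k'"
  using assms
proof (induction k k' B B' arbitrary: U U' M rule: frame_lagrangian.induct)
  case (1 k k' q B B')
  obtain x y where q: "q = (x, y)" by force
  note p = 1(2)
  have xy: "x \<in> U" "y \<in> U" "b x y = 1" and B: "frame (cut x y U) B" using 1(3) q by auto
  let ?L = "frame_lagrangian k k' B B'" and ?A = "adjoin x (frame_lagrangian k k' B B')"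
  have IH: "lagrangian (osum (cut x y U) U') ?L" "card (?L \<inter> cut x y U) = CARD('a) ^ k"
    "card (?L \<inter> U') = CARD('a) ^ k'"
    using 1(1)[OF symplectic_pair_cut[OF p xy] B 1(4), of M] 1(5,6) by auto
  have in_V: "x \<in> osum U U'" "y \<in> osum U U'" using xy osum_superset[OF p] by auto
  have L: "lagrangian (osum U U') ?A"
    using lagrangian_adjoin[OF symplectic_osum[OF p] in_V xy(3)] IH(1) by (simp add: cut_osum[OF p xy(1,2)])
  have sub: "?L \<subseteq> cut x y (osum U U')" using lagrangianD(1)[OF IH(1)] by (simp add: cut_osum[OF p xy(1,2)])
  have cut: "cut x y ?A = ?L"
    by (rule cut_adjoin[OF xy(3)]) (use sub symplecticD(2)[OF symplectic_pairD(1)[OF p] xy(1)] in \<open>auto simp: cut_def\<close>)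
  have "x \<in> ?A"
    by (rule mem_adjoin_self[OF subspace_lagrangian[OF symplecticD(1)[OF symplectic_osum[OF symplectic_pair_cut[OF p xy]]] IH(1)]])
  from lagrangian_cut_left(3,4)[OF p L this xy] show ?case
    using L IH(2,3) by (simp add: q cut)
next
  case (2 k' B q B')
  obtain x y where q: "q = (x, y)" by force
  \<comment> \<open>The vector is adjoined on the primed side; exchanging the summands makes the
    facts about the left summand applicable.\<close>
  note p = 2(2) and p' = symplectic_pair_commute[OF 2(2)]
  have xy: "x \<in> U'" "y \<in> U'" "b x y = 1" and B: "frame (cut x y U') B'" using 2(4) q by auto
  let ?L = "frame_lagrangian 0 k' B B'" and ?A = "adjoin x (frame_lagrangian 0 k' B B')"
  have IH: "lagrangian (osum (cut x y U') U) ?L" "card (?L \<inter> U) = 1"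
    "card (?L \<inter> cut x y U') = CARD('a) ^ k'"
    using 2(1)[OF symplectic_pair_commute[OF symplectic_pair_cut[OF p' xy]] 2(3) B, of M] 2(5,6)
    by (auto simp: osum_commute)
  have in_V: "x \<in> osum U' U" "y \<in> osum U' U" using xy osum_superset[OF p'] by auto
  have L: "lagrangian (osum U' U) ?A"
    using lagrangian_adjoin[OF symplectic_osum[OF p'] in_V xy(3)] IH(1) by (simp add: cut_osum[OF p' xy(1,2)])
  have sub: "?L \<subseteq> cut x y (osum U' U)" using lagrangianD(1)[OF IH(1)] by (simp add: cut_osum[OF p' xy(1,2)])
  have cut: "cut x y ?A = ?L"
    by (rule cut_adjoin[OF xy(3)]) (use sub symplecticD(2)[OF symplectic_pairD(1)[OF p'] xy(1)] in \<open>auto simp: cut_def\<close>)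
  have "x \<in> ?A"
    by (rule mem_adjoin_self[OF subspace_lagrangian[OF symplecticD(1)[OF symplectic_osum[OF symplectic_pair_cut[OF p' xy]]] IH(1)]])
  from lagrangian_cut_left(3,4)[OF p' L this xy] show ?case
    using L IH(2,3) by (simp add: q cut osum_commute)
next
  case (3 q B q' B')
  obtain x y where q: "q = (x, y)" by force
  obtain x' y' where q': "q' = (x', y')" by force
  note p = 3(2) and p' = symplectic_pair_commute[OF 3(2)]
  note 0 = symplectic_pairD(3,4)[OF p]
  have xy: "x \<in> U" "y \<in> U" "b x y = 1" and B: "frame (cut x y U) B" using 3(3) q by auto
  have xy': "x' \<in> U'" "y' \<in> U'" "b x' y' = 1" and B': "frame (cut x' y' U') B'" using 3(4) q' by auto
  let ?L = "frame_lagrangian 0 0 B B'"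
  have pc: "symplectic_pair (cut x y U) (cut x' y' U')"
    using symplectic_pair_commute[OF symplectic_pair_cut[OF symplectic_pair_commute[OF symplectic_pair_cut[OF p xy]] xy']] .
  have IH: "lagrangian (osum (cut x y U) (cut x' y' U')) ?L" "card (?L \<inter> cut x y U) = 1"
    "card (?L \<inter> cut x' y' U') = 1"
    \<comment> \<open>Both frames are nonempty and \<open>k\<close>, \<open>k'\<close> are 0, so
      \<open>M\<close> is at least 1 and the subtraction is exact.\<close>
    using 3(1)[OF pc B B', of "M - 1"] 3(5,6) by auto
  have sL: "subspace ?L" using subspace_lagrangian[OF symplecticD(1)[OF symplectic_osum[OF pc]] IH(1)] .
  have I: "?L \<inter> cut x y U = {0}" "?L \<inter> cut x' y' U' = {0}"
    using IH(2,3) card_eq_1_subspace[OF subspace_inter[OF sL]]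
      symplectic_pairD(1,2)[OF pc, THEN symplecticD(1)] by auto
  let ?V = "osum U U'"
  have V: "symplectic ?V" using symplectic_osum[OF p] .
  have in_V: "x + x' \<in> ?V" "y \<in> ?V" "y + y' \<in> ?V" "x' \<in> ?V"
    using osumI xy xy' osum_superset[OF p] by auto
  have b1: "b (x + x') y = 1" using 0 xy xy' by simp
  have V1: "symplectic (cut (x + x') y ?V)" using symplectic_cut[OF V in_V(1,2) b1] .
  note alt = symplectic_pairD(1,2)[OF p, THEN symplecticD(2)]
  have in_V1: "y + y' \<in> cut (x + x') y ?V" "x' \<in> cut (x + x') y ?V"
    using in_V 0 xy xy' alt by (auto simp: cut_def)
  have b2: "b (y + y') x' = 1" using 0 xy xy' by (simp add: form_commute[of y' x'])
  have "lagrangian (cut (x + x') y ?V) (adjoin (y + y') ?L)"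
    using lagrangian_adjoin[OF V1 in_V1 b2] IH(1) by (simp add: cut_graph[OF p xy(1,2) xy'(1,2)])
  then have "lagrangian ?V (adjoin (x + x') (adjoin (y + y') ?L))"
    using lagrangian_adjoin[OF V in_V(1,2) b1] by blast
  moreover have "adjoin (x + x') (adjoin (y + y') ?L) \<inter> U = {0}"
    using adjoin_graph_Int[OF p xy xy' lagrangianD(1)[OF IH(1)] I(1)] .
  moreover have "adjoin (x + x') (adjoin (y + y') ?L) \<inter> U' = {0}"
    using adjoin_graph_Int[OF p' xy' xy _ I(2)] lagrangianD(1)[OF IH(1)] by (simp add: osum_commute add.commute)
  ultimately show ?case by (simp add: q q')
qed (auto simp: osum_def lagrangian_zero)

end

subsection \<open>Counting\<close>

text \<open>This is the order of Sp(2m, q). With 2i dimensions left, a nonzero vector is chosen and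
  then one of its q^(2i-1) partners.\<close>

definition frame_count :: "nat \<Rightarrow> nat \<Rightarrow> nat" where
  "frame_count q m = (\<Prod>i = 1..m. (q ^ (2 * i) - 1) * q ^ (2 * i - 1))"

text \<open>Counts the choices of the \<open>k\<close> pairs whose first vectors span the
  intersection with one summand. When \<open>i\<close> of them remain, the intersection has q^i - 1
  nonzero vectors, and the partners are taken in a space of dimension 2(i + M).\<close>

definition isotropic_factor :: "nat \<Rightarrow> nat \<Rightarrow> nat \<Rightarrow> nat" where
  "isotropic_factor q k M = (\<Prod>i = 1..k. (q ^ i - 1) * q ^ (2 * (i + M) - 1))"

context char2_form
begin

lemma card_image_Sigma:
  assumes "inj_on f (Sigma P A)" "finite P" "\<And>p. p \<in> P \<Longrightarrow> finite (A p)" "\<And>p. p \<in> P \<Longrightarrow> card (A p) = c"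
  shows "card (f ` Sigma P A) = card P * c"
  using assms by (simp add: card_image)

lemma finite_hyperbolic_pairs: "finite (hyperbolic_pairs A U)"
  by (rule finite_subset[of _ "A \<times> U"]) (auto simp: hyperbolic_pairs_def)

text \<open>The partners of a nonzero \<open>x\<close> form a level set of \<open>b x\<close>, a
  fraction 1/q of \<open>U\<close>. The set \<open>A\<close> restricts only the first vector: all of
  \<open>U\<close> for frames, the intersection with \<open>L\<close> for adapted pairs.\<close>

lemma card_hyperbolic_pairs:
  assumes U: "symplectic U" "card U = CARD('a) ^ (2 * m)" and A: "A \<subseteq> U" "0 \<in> A"
  shows "card (hyperbolic_pairs A U) = (card A - 1) * CARD('a) ^ (2 * m - 1)"
proof -
  have "card {y \<in> U. b x y = 1} = CARD('a) ^ (2 * m - 1)" if x: "x \<in> A - {0}" for x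
  proof -
    have xU: "x \<in> U" using x A by blast
    obtain y where y: "y \<in> U" "b x y = 1" using symplectic_dual[OF U(1) xU] x by blast
    \<comment> \<open>Otherwise the exponent \<open>2 * m - 1\<close> would be truncated.\<close>
    have "m \<noteq> 0"
    proof
      assume "m = 0"
      then have "card U = 1" using U(2) by simp
      moreover have "0 \<in> U" using A by blast
      ultimately show False using xU x by (auto simp: card_1_singleton_iff)
    qed
    then have "card U = CARD('a) * CARD('a) ^ (2 * m - 1)"
      using U(2) by (cases m) auto
    then show ?thesis using card_level_set[OF symplecticD(1)[OF U(1)] y, of 1] by simp
  qed
  moreover have "hyperbolic_pairs A U = Sigma (A - {0}) (\<lambda>x. {y \<in> U. b x y = 1})"
    by (auto simp: hyperbolic_pairs_def)
  ultimately show ?thesis using A(2) by simp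
qed

lemma card_cut_exponent:
  assumes "symplectic U" "card U = CARD('a) ^ (2 * Suc m)" "x \<in> U" "y \<in> U" "b x y = 1"
  shows "card (cut x y U) = CARD('a) ^ (2 * m)"
  using card_cut[OF symplecticD(1)[OF assms(1)] assms(3,4,5)] symplecticD(2)[OF assms(1)] assms
  by (simp add: power2_eq_square)

lemma symplectic_card_1: "symplectic U \<Longrightarrow> card U = 1 \<Longrightarrow> U = {0}"
  using card_eq_1_subspace symplecticD(1) by blast

lemma card_frames:
  assumes "symplectic U" "card U = CARD('a) ^ (2 * m)"
  shows "card {B. frame U B} = frame_count CARD('a) m"
  using assms
proof (induction m arbitrary: U)
  case 0
  then have "U = {0}" using symplectic_card_1 by simp
  then have "{B. frame U B} = {[]}"
    using frame_length_eq[OF 0(1) _ 0(2)] by auto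
  then show ?case by (simp add: frame_count_def)
next
  case (Suc m)
  note U = Suc.prems
  let ?f = "\<lambda>(p, B). p # B"
  let ?A = "\<lambda>p. {B. frame (cut (fst p) (snd p) U) B}"
  let ?P = "hyperbolic_pairs U U"
  have P: "fst p \<in> U" "snd p \<in> U" "b (fst p) (snd p) = 1" if "p \<in> ?P" for p
    using that by (auto simp: hyperbolic_pairs_def)
  have "{B. frame U B} = ?f ` Sigma ?P ?A"
  proof (intro equalityI subsetI)
    fix B assume "B \<in> {B. frame U B}"
    then have B: "frame U B" by simp
    then have "length B = Suc m" using frame_length_eq[OF U(1) _ U(2)] by blast
    then obtain p B1 where "B = p # B1" by (cases B) auto
    then show "B \<in> ?f ` Sigma ?P ?A" using B by (force simp: hyperbolic_pairs_def)
  qed (auto simp: hyperbolic_pairs_def)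
  moreover have "card (?f ` Sigma ?P ?A) = card ?P * frame_count CARD('a) m"
  proof (rule card_image_Sigma)
    show "inj_on ?f (Sigma ?P ?A)" by (auto simp: inj_on_def)
    fix p assume "p \<in> ?P"
    note p = P[OF this]
    show "finite (?A p)" using finite_frames[OF symplectic_cut[OF U(1) p]] .
    show "card (?A p) = frame_count CARD('a) m"
      using Suc.IH[OF symplectic_cut[OF U(1) p] card_cut_exponent[OF U p]] .
  qed (rule finite_hyperbolic_pairs)
  moreover have "card ?P = (card U - 1) * CARD('a) ^ (2 * Suc m - 1)"
    using card_hyperbolic_pairs[OF U subset_refl subspace_0[OF symplecticD(1)[OF U(1)]]] .
  ultimately show ?case using U(2) by (simp add: frame_count_def mult.commute)
qed

text \<open>Here \<open>L\<close> is the graph of an isometry \<open>g\<close>, so an adapted pair of frames amounts to a frame of \<open>U\<close>.\<close>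

lemma card_adapted_0_0:
  assumes "symplectic_pair U U'" "lagrangian (osum U U') L" "card (L \<inter> U) = 1" "card (L \<inter> U') = 1"
    "card U = CARD('a) ^ (2 * m)"
  shows "card (adapted 0 0 U U' L) = frame_count CARD('a) m"
  using assms
proof (induction m arbitrary: U U' L)
  case 0
  note p = 0(1) and L = 0(2)
  have sL: "subspace L" using subspace_lagrangian[OF symplecticD(1)[OF symplectic_osum[OF p]] L] .
  note sU = symplectic_pairD(1,2)[OF p, THEN symplecticD(1)]
  have I: "L \<inter> U = {0}" "L \<inter> U' = {0}"
    using 0(3,4) card_eq_1_subspace[OF subspace_inter[OF sL]] sU by auto
  have U: "U = {0}" using symplectic_card_1[OF symplectic_pairD(1)[OF p]] 0(5) by simp
  have "card U' = 1" using lagrangian_graph(1)[OF p L I] U by simp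
  then have U': "U' = {0}" using symplectic_card_1[OF symplectic_pairD(2)[OF p]] by simp
  have "B = []" if "frame {0} B" for B
    using frame_length_eq[OF symplectic_pairD(1)[OF p], of B 0] U that by simp
  moreover have "L = {0}" using lagrangianD(1)[OF L] subspace_0[OF sL] U U' by (auto simp: osum_def)
  ultimately have "adapted 0 0 U U' L = {([], [])}" unfolding adapted_def U U' by auto
  then show ?case by (simp add: frame_count_def)
next
  case (Suc m)
  note p = Suc.prems(1) and p' = symplectic_pair_commute[OF Suc.prems(1)] and L = Suc.prems(2)
  have sL: "subspace L" using subspace_lagrangian[OF symplecticD(1)[OF symplectic_osum[OF p]] L] .
  note sU = symplectic_pairD(1,2)[OF p, THEN symplecticD(1)]
  note alt = symplectic_pairD(1,2)[OF p, THEN symplecticD(2)]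
  note 0 = symplectic_pairD(3,4)[OF p]
  have I: "L \<inter> U = {0}" "L \<inter> U' = {0}"
    using Suc.prems(3,4) card_eq_1_subspace[OF subspace_inter[OF sL]] sU by auto
  have cU': "card U' = CARD('a) ^ (2 * Suc m)" using lagrangian_graph(1)[OF p L I] Suc.prems(5) by simp
  have "\<forall>x\<in>U. \<exists>x'. x' \<in> U' \<and> x + x' \<in> L" using lagrangian_graph(2)[OF p L I] by blast
  then obtain g where g: "\<And>x. x \<in> U \<Longrightarrow> g x \<in> U' \<and> x + g x \<in> L" by metis
  have g_eq: "x' = g x" if "x \<in> U" "x' \<in> U'" "x + x' \<in> L" for x x'
    using lagrangian_graph(2)[OF p L I that(1)] g[OF that(1)] that by blast
  \<comment> \<open>Two elements of the graph are orthogonal, so \<open>b x y + b x' y' = 0\<close>;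
    in characteristic 2 the graph is therefore that of an isometry, not of an anti-isometry.\<close>
  have b_eq: "b x' y' = b x y"
    if "x \<in> U" "y \<in> U" "x' \<in> U'" "y' \<in> U'" "x + x' \<in> L" "y + y' \<in> L" for x y x' y'
    using lagrangianD(2)[OF L that(5,6)] 0 that by simp
  let ?P = "hyperbolic_pairs U U"
  let ?V = "\<lambda>p. cut (fst p) (snd p) U"
  let ?V' = "\<lambda>p. cut (g (fst p)) (g (snd p)) U'"
  let ?L = "\<lambda>p. L \<inter> osum (?V p) (?V' p)"
  let ?A = "\<lambda>p. adapted 0 0 (?V p) (?V' p) (?L p)"
  \<comment> \<open>The first pair of the second frame is forced to be the image under
    \<open>g\<close> of the first pair of the first frame, so it contributes no factor to the
    count.\<close>
  let ?f = "\<lambda>(p, (B, B')). (p # B, (g (fst p), g (snd p)) # B')"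
  have P: "fst p \<in> U" "snd p \<in> U" "b (fst p) (snd p) = 1" "g (fst p) \<in> U'" "g (snd p) \<in> U'"
    "b (g (fst p)) (g (snd p)) = 1" "fst p + g (fst p) \<in> L" "snd p + g (snd p) \<in> L" if "p \<in> ?P" for p
    using that g b_eq by (auto simp: hyperbolic_pairs_def)
  have pc: "symplectic_pair (?V r) (?V' r)" if "r \<in> ?P" for r
    using symplectic_pair_commute[OF symplectic_pair_cut[OF symplectic_pair_commute[OF
      symplectic_pair_cut[OF p P(1-3)[OF that]]] P(4-6)[OF that]]] .
  have step: "lagrangian (osum (?V r) (?V' r)) (?L r)"
    "L = adjoin (fst r + g (fst r)) (adjoin (snd r + g (snd r)) (?L r))" if "r \<in> ?P" for r
  proof -
    obtain x y where r: "r = (x, y)" by force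
    let ?x = "g x" and ?y = "g y"
    have xy: "x \<in> U" "y \<in> U" "b x y = 1" "?x \<in> U'" "?y \<in> U'" "b ?x ?y = 1" "x + ?x \<in> L" "y + ?y \<in> L"
      using P[OF that] by (auto simp: r)
    let ?W = "osum U U'"
    have W: "symplectic ?W" using symplectic_osum[OF p] .
    have in_W: "y \<in> ?W" "?x \<in> ?W" using xy osum_superset[OF p] by auto
    have b1: "b (x + ?x) y = 1" using 0 xy by simp
    let ?W1 = "cut (x + ?x) y ?W" and ?L1 = "cut (x + ?x) y L"
    have xW: "x + ?x \<in> ?W" using xy lagrangianD(1)[OF L] by blast
    note L1 = lagrangian_cut[OF W L xy(7) in_W(1) b1]
    have W1: "symplectic ?W1" using symplectic_cut[OF W xW in_W(1) b1] .
    have b2: "b (y + ?y) ?x = 1" using 0 xy by (simp add: form_commute[of ?y ?x])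
    have "y + ?y \<in> ?L1" "?x \<in> ?W1"
      using xy in_W 0 alt lagrangianD(2)[OF L] by (auto simp: cut_def)
    note L2 = lagrangian_cut[OF W1 L1(1) this b2]
    have W2: "cut (y + ?y) ?x ?W1 = osum (cut x y U) (cut ?x ?y U')"
      using cut_graph[OF p xy(1,2,4,5)] .
    have "cut (y + ?y) ?x ?L1 = L \<inter> cut (y + ?y) ?x ?W1"
      using lagrangianD(1)[OF L] by (auto simp: cut_def)
    then have L2_eq: "cut (y + ?y) ?x ?L1 = ?L r" by (simp add: W2 r)
    show "lagrangian (osum (?V r) (?V' r)) (?L r)" using L2(1) by (simp only: L2_eq W2) (simp add: r)
    have "L = adjoin (x + ?x) (adjoin (y + ?y) (?L r))"
      using L1(2) L2(2) by (simp only: L2_eq)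
    then show "L = adjoin (fst r + g (fst r)) (adjoin (snd r + g (snd r)) (?L r))" by (simp add: r)
  qed
  have "adapted 0 0 U U' L = ?f ` Sigma ?P ?A"
  proof (intro equalityI subsetI)
    fix z assume "z \<in> adapted 0 0 U U' L"
    then obtain B B' where z: "z = (B, B')" and B: "frame U B" "frame U' B'" "frame_lagrangian 0 0 B B' = L"
      by (auto simp: adapted_def)
    have len: "length B = Suc m" "length B' = Suc m"
      using frame_length_eq[OF symplectic_pairD(1)[OF p] B(1) Suc.prems(5)]
        frame_length_eq[OF symplectic_pairD(2)[OF p] B(2) cU'] by auto
    obtain r B1 where B1: "B = r # B1" using len by (cases B) auto
    obtain r' B1' where B1': "B' = r' # B1'" using len by (cases B') auto
    have fr: "fst r \<in> U" "snd r \<in> U" "b (fst r) (snd r) = 1" "frame (?V r) B1"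
      "fst r' \<in> U'" "snd r' \<in> U'" "b (fst r') (snd r') = 1" "frame (cut (fst r') (snd r') U') B1'"
      using B by (auto simp: B1 B1')
    have Leq: "L = adjoin (fst r + fst r') (adjoin (snd r + snd r') (frame_lagrangian 0 0 B1 B1'))"
      using B(3) by (simp add: B1 B1')
    let ?V1 = "cut (fst r') (snd r') U'"
    have pc1: "symplectic_pair (?V r) ?V1"
      using symplectic_pair_commute[OF symplectic_pair_cut[OF symplectic_pair_commute[OF
        symplectic_pair_cut[OF p fr(1-3)]] fr(5-7)]] .
    have lag1: "lagrangian (osum (?V r) ?V1) (frame_lagrangian 0 0 B1 B1')"
      using lagrangian_frame_lagrangian[OF pc1 fr(4,8), of 0 m 0] len by (simp add: B1 B1')
    have s1: "subspace (frame_lagrangian 0 0 B1 B1')"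
      using subspace_lagrangian[OF symplecticD(1)[OF symplectic_osum[OF pc1]] lag1] .
    have in_L: "fst r + fst r' \<in> L" "snd r + snd r' \<in> L" "frame_lagrangian 0 0 B1 B1' \<subseteq> L"
      using mem_adjoin_self[OF s1] mem_adjoin_self[OF subspace_adjoin[OF s1]] adjoin_superset
      unfolding Leq by blast+
    have r': "fst r' = g (fst r)" "snd r' = g (snd r)"
      using g_eq fr in_L by auto
    have rP: "r \<in> ?P" using fr by (auto simp: hyperbolic_pairs_def case_prod_beta)
    \<comment> \<open>The left side is Lagrangian in the smaller sum and contained in the totally
      isotropic right side, so the two coincide.\<close>
    have "frame_lagrangian 0 0 B1 B1' = ?L r"
    proof
      show "frame_lagrangian 0 0 B1 B1' \<subseteq> ?L r" using in_L(3) lagrangianD(1)[OF lag1] r' by auto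
      show "?L r \<subseteq> frame_lagrangian 0 0 B1 B1'"
      proof
        fix v assume v: "v \<in> ?L r"
        show "v \<in> frame_lagrangian 0 0 B1 B1'"
          by (rule lagrangianD(3)[OF lag1]) (use v r' in_L(3) lagrangianD(2)[OF L] in auto)
      qed
    qed
    then have "(B1, B1') \<in> ?A r" using fr r' by (simp add: adapted_def)
    moreover have "z = ?f (r, (B1, B1'))" using r' by (simp add: z B1 B1' prod_eq_iff)
    ultimately show "z \<in> ?f ` Sigma ?P ?A" using rP by blast
  next
    fix z assume "z \<in> ?f ` Sigma ?P ?A"
    then obtain r B B' where r: "r \<in> ?P" and B: "frame (?V r) B" "frame (?V' r) B'" "frame_lagrangian 0 0 B B' = ?L r"
      and z: "z = (r # B, (g (fst r), g (snd r)) # B')"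
      by (auto simp: adapted_def)
    have "frame_lagrangian 0 0 (r # B) ((g (fst r), g (snd r)) # B') = L"
      using step(2)[OF r] by (simp only: frame_lagrangian.simps fst_conv snd_conv B(3))
    then show "z \<in> adapted 0 0 U U' L" using B(1,2) P[OF r] by (simp add: z adapted_def)
  qed
  moreover have "card (?f ` Sigma ?P ?A) = card ?P * frame_count CARD('a) m"
  proof (rule card_image_Sigma)
    show "inj_on ?f (Sigma ?P ?A)" by (auto simp: inj_on_def)
    fix r assume r: "r \<in> ?P"
    show "finite (?A r)" using finite_adapted[OF pc[OF r]] .
    note lag = step(1)[OF r]
    have sLr: "subspace (?L r)"
      using subspace_lagrangian[OF symplecticD(1)[OF symplectic_osum[OF pc[OF r]]] lag] .
    have "?L r \<inter> ?V r = {0}" "?L r \<inter> ?V' r = {0}"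
      using I subspace_0[OF sLr] symplectic_pairD(1,2)[OF pc[OF r], THEN symplecticD(1), THEN subspace_0]
        cut_subset by blast+
    then show "card (?A r) = frame_count CARD('a) m"
      using Suc.IH[OF pc[OF r] lag] card_cut_exponent[OF symplectic_pairD(1)[OF p] Suc.prems(5) P(1-3)[OF r]]
      by simp
  qed (rule finite_hyperbolic_pairs)
  moreover have "card ?P = (card U - 1) * CARD('a) ^ (2 * Suc m - 1)"
    using card_hyperbolic_pairs[OF symplectic_pairD(1)[OF p] Suc.prems(5) subset_refl subspace_0[OF sU(1)]] .
  ultimately show ?case using Suc.prems(5) by (simp add: frame_count_def mult.commute)
qed

lemma card_adapted_swap: "card (adapted 0 k U U' L) = card (adapted k 0 U' U L)"
proof -
  have "adapted k 0 U' U L = prod.swap ` adapted 0 k U U' L"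
    by (auto simp: adapted_def frame_lagrangian_commute image_iff)
  then show ?thesis by (simp add: card_image)
qed

text \<open>Peels off the pairs of the left frame whose first vectors lie in \<open>L\<close>. The
  count \<open>c\<close> for a trivial intersection is left abstract, so the lemma serves twice: for
  \<open>U\<close>, and after exchanging the summands for \<open>U'\<close>.\<close>

lemma card_adapted_left:
  assumes base: "\<And>U L. symplectic_pair U U' \<Longrightarrow> lagrangian (osum U U') L \<Longrightarrow> card (L \<inter> U) = 1 \<Longrightarrow>
      card (L \<inter> U') = CARD('a) ^ k' \<Longrightarrow> card U = CARD('a) ^ (2 * M) \<Longrightarrow> card (adapted 0 k' U U' L) = c"
    and U': "card U' = CARD('a) ^ (2 * (k' + M))"
    and "symplectic_pair U U'" "lagrangian (osum U U') L" "card (L \<inter> U) = CARD('a) ^ k"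
      "card (L \<inter> U') = CARD('a) ^ k'" "card U = CARD('a) ^ (2 * (k + M))"
  shows "card (adapted k k' U U' L) = isotropic_factor CARD('a) k M * c"
  using assms(3-)
proof (induction k arbitrary: U L)
  case 0
  then show ?case using base by (simp add: isotropic_factor_def)
next
  case (Suc k)
  note p = Suc.prems(1) and L = Suc.prems(2)
  have cU: "card U = CARD('a) ^ (2 * Suc (k + M))" using Suc.prems(5) by simp
  have sL: "subspace L" using subspace_lagrangian[OF symplecticD(1)[OF symplectic_osum[OF p]] L] .
  note U = symplectic_pairD(1)[OF p]
  note sU = symplecticD(1)[OF U]
  let ?P = "hyperbolic_pairs (L \<inter> U) U"
  let ?V = "\<lambda>r. cut (fst r) (snd r) U"
  let ?L = "\<lambda>r. cut (fst r) (snd r) L"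
  let ?A = "\<lambda>r. adapted k k' (?V r) U' (?L r)"
  let ?f = "\<lambda>(p, (B, B')). (p # B, B')"
  have P: "fst r \<in> L" "fst r \<in> U" "snd r \<in> U" "b (fst r) (snd r) = 1" if "r \<in> ?P" for r
    using that by (auto simp: hyperbolic_pairs_def)
  have pc: "symplectic_pair (?V r) U'" if "r \<in> ?P" for r
    using symplectic_pair_cut[OF p P(2-4)[OF that]] .
  have "adapted (Suc k) k' U U' L = ?f ` Sigma ?P ?A"
  proof (intro equalityI subsetI)
    fix z assume "z \<in> adapted (Suc k) k' U U' L"
    then obtain B B' where z: "z = (B, B')" and B: "frame U B" "frame U' B'" "frame_lagrangian (Suc k) k' B B' = L"
      by (auto simp: adapted_def)
    have len: "length B = Suc (k + M)" "length B' = k' + M"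
      using frame_length_eq[OF U B(1) cU] frame_length_eq[OF symplectic_pairD(2)[OF p] B(2) U'] by auto
    obtain r B1 where B1: "B = r # B1" using len by (cases B) auto
    have fr: "fst r \<in> U" "snd r \<in> U" "b (fst r) (snd r) = 1" "frame (?V r) B1" using B(1) by (auto simp: B1)
    have Leq: "adjoin (fst r) (frame_lagrangian k k' B1 B') = L" using B(3) by (simp add: B1)
    have pr: "symplectic_pair (?V r) U'" using symplectic_pair_cut[OF p fr(1-3)] .
    have lag1: "lagrangian (osum (?V r) U') (frame_lagrangian k k' B1 B')"
      using lagrangian_frame_lagrangian[OF pr fr(4) B(2), of k M k'] len by (simp add: B1)
    have s1: "subspace (frame_lagrangian k k' B1 B')"
      using subspace_lagrangian[OF symplecticD(1)[OF symplectic_osum[OF pr]] lag1] .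
    have "fst r \<in> L" using mem_adjoin_self[OF s1, of "fst r"] by (simp add: Leq)
    then have r: "r \<in> ?P" using fr by (auto simp: hyperbolic_pairs_def case_prod_beta)
    have "frame_lagrangian k k' B1 B' \<subseteq> cut (fst r) (snd r) (osum U U')"
      using lagrangianD(1)[OF lag1] by (simp add: cut_osum[OF p fr(1,2)])
    then have "\<And>l. l \<in> frame_lagrangian k k' B1 B' \<Longrightarrow> b (fst r) l = 0 \<and> b (snd r) l = 0" by (auto simp: cut_def)
    then have "?L r = frame_lagrangian k k' B1 B'"
      using cut_adjoin[OF fr(3) symplecticD(2)[OF U fr(1)], of "frame_lagrangian k k' B1 B'"] by (simp add: Leq)
    then have "(B1, B') \<in> ?A r" using fr(4) B(2) by (simp add: adapted_def)
    moreover have "z = ?f (r, (B1, B'))" by (simp add: z B1)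
    ultimately show "z \<in> ?f ` Sigma ?P ?A" using r by blast
  next
    fix z assume "z \<in> ?f ` Sigma ?P ?A"
    then obtain r B B' where r: "r \<in> ?P" and B: "frame (?V r) B" "frame U' B'" "frame_lagrangian k k' B B' = ?L r"
      and z: "z = (r # B, B')"
      by (auto simp: adapted_def)
    have "frame_lagrangian (Suc k) k' (r # B) B' = L"
      using lagrangian_cut_left(2)[OF p L P[OF r]] by (simp add: B(3))
    then show "z \<in> adapted (Suc k) k' U U' L" using B(1,2) P[OF r] by (simp add: z adapted_def)
  qed
  moreover have "card (?f ` Sigma ?P ?A) = card ?P * (isotropic_factor CARD('a) k M * c)"
  proof (rule card_image_Sigma)
    show "inj_on ?f (Sigma ?P ?A)" by (auto simp: inj_on_def)
    fix r assume r: "r \<in> ?P"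
    show "finite (?A r)" using finite_adapted[OF pc[OF r]] .
    note lag = lagrangian_cut_left[OF p L P[OF r]]
    have "card (?L r \<inter> ?V r) = CARD('a) ^ k" using lag(3) Suc.prems(3) by simp
    then show "card (?A r) = isotropic_factor CARD('a) k M * c"
      using Suc.IH[OF pc[OF r] lag(1)] card_cut_exponent[OF U cU P(2-4)[OF r]] lag(4) Suc.prems(4) by simp
  qed (rule finite_hyperbolic_pairs)
  moreover have "card ?P = (card (L \<inter> U) - 1) * CARD('a) ^ (2 * Suc (k + M) - 1)"
    using card_hyperbolic_pairs[OF U cU, of "L \<inter> U"] subspace_0[OF sU] subspace_0[OF sL] by simp
  ultimately show ?case using Suc.prems(3) by (simp add: isotropic_factor_def ac_simps)
qed

lemma card_adapted:
  assumes p: "symplectic_pair U U'" and L: "lagrangian (osum U U') L"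
    and I: "card (L \<inter> U) = CARD('a) ^ k" "card (L \<inter> U') = CARD('a) ^ k'"
    and c: "card U = CARD('a) ^ (2 * (k + M))" "card U' = CARD('a) ^ (2 * (k' + M))"
  shows "card (adapted k k' U U' L) =
    isotropic_factor CARD('a) k M * (isotropic_factor CARD('a) k' M * frame_count CARD('a) M)"
proof (rule card_adapted_left[OF _ c(2) p L I c(1)])
  fix U L assume p: "symplectic_pair U U'" and L: "lagrangian (osum U U') L" and I: "card (L \<inter> U) = 1"
    "card (L \<inter> U') = CARD('a) ^ k'" and cU: "card U = CARD('a) ^ (2 * M)"
  have "card (adapted k' 0 U' U L) = isotropic_factor CARD('a) k' M * frame_count CARD('a) M"
  proof (rule card_adapted_left)
    show "symplectic_pair U' U" using symplectic_pair_commute[OF p] .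
    show "lagrangian (osum U' U) L" using L by (simp add: osum_commute)
  qed (use I cU c(2) card_adapted_0_0 in auto)
  then show "card (adapted 0 k' U U' L) = isotropic_factor CARD('a) k' M * frame_count CARD('a) M"
    by (simp add: card_adapted_swap)
qed

text \<open>Comparing exponents gives m - k = M = m' - k', hence k' = k + m' - m; the second
  conclusion makes this subtraction exact.\<close>

lemma lagrangian_shape_unique:
  assumes p: "symplectic_pair U U'" and L: "lagrangian (osum U U') L"
    and c: "card U = CARD('a) ^ (2 * m)" "card U' = CARD('a) ^ (2 * m')" and k: "card (L \<inter> U) = CARD('a) ^ k"
  shows "k \<le> m" "m \<le> k + m'" "card (L \<inter> U') = CARD('a) ^ (k + m' - m)"
proof -
  obtain j j' M where *: "card (L \<inter> U) = CARD('a) ^ j" "card (L \<inter> U') = CARD('a) ^ j'"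
    "card U = CARD('a) ^ (2 * (j + M))" "card U' = CARD('a) ^ (2 * (j' + M))"
    using lagrangian_shape[OF p L] by blast
  then have "j = k" "m = k + M" "m' = j' + M"
    using c k card_scalar_gt_1 by auto
  then show "k \<le> m" "m \<le> k + m'" "card (L \<inter> U') = CARD('a) ^ (k + m' - m)" using * by auto
qed

text \<open>Double counting of all pairs of frames: with \<open>k\<close> and \<open>k'\<close>
  fixed, the fibres of \<open>frame_lagrangian\<close> are the sets of adapted pairs, which all have
  the same size.\<close>

lemma card_lagrangian_type:
  assumes p: "symplectic_pair U U'"
    and c: "card U = CARD('a) ^ (2 * (k + M))" "card U' = CARD('a) ^ (2 * (k' + M))"
  shows "card {L. lagrangian (osum U U') L \<and> card (L \<inter> U) = CARD('a) ^ k} *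
      (isotropic_factor CARD('a) k M * (isotropic_factor CARD('a) k' M * frame_count CARD('a) M)) =
    frame_count CARD('a) (k + M) * frame_count CARD('a) (k' + M)"
proof -
  let ?T = "{L. lagrangian (osum U U') L \<and> card (L \<inter> U) = CARD('a) ^ k}"
  let ?N = "isotropic_factor CARD('a) k M * (isotropic_factor CARD('a) k' M * frame_count CARD('a) M)"
  have len: "length B = k + M" "length B' = k' + M" if "frame U B" "frame U' B'" for B B'
    using frame_length_eq[OF symplectic_pairD(1)[OF p] that(1) c(1)]
      frame_length_eq[OF symplectic_pairD(2)[OF p] that(2) c(2)] .
  have "{B. frame U B} \<times> {B'. frame U' B'} = (\<Union>L\<in>?T. adapted k k' U U' L)"
    using lagrangian_frame_lagrangian[OF p _ _ len] by (auto simp: adapted_def)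
  then have "card {B. frame U B} * card {B'. frame U' B'} = card (\<Union>L\<in>?T. adapted k k' U U' L)"
    by (simp only: card_cartesian_product[symmetric])
  also have "\<dots> = (\<Sum>L\<in>?T. card (adapted k k' U U' L))"
  proof (rule card_UN_disjoint)
  qed (use finite_adapted[OF p] in \<open>auto simp: adapted_def\<close>)
  also have "\<dots> = (\<Sum>L\<in>?T. ?N)"
  proof (rule sum.cong[OF refl])
    fix L assume L: "L \<in> ?T"
    show "card (adapted k k' U U' L) = ?N"
      using card_adapted[OF p _ _ _ c] lagrangian_shape_unique[OF p _ c, of L k] L by auto
  qed
  finally show ?thesis
    by (simp add: card_frames[OF symplectic_pairD(1)[OF p] c(1)] card_frames[OF symplectic_pairD(2)[OF p] c(2)])
qed

text \<open>The degenerate instance with second summand {0}, where a Lagrangian lies entirely in the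
  first summand and the graph part is empty.\<close>

lemma card_lagrangians:
  assumes V: "symplectic V" "card V = CARD('a) ^ (2 * N)"
  shows "card {L. lagrangian V L} * isotropic_factor CARD('a) N 0 = frame_count CARD('a) N"
proof -
  have p: "symplectic_pair V {0}"
    using V(1) by (auto simp: symplectic_pair_def symplectic_def)
  have V0: "osum V {0} = V" by (auto simp: osum_def)
  have "card (L \<inter> V) = CARD('a) ^ N" if "lagrangian V L" for L
  proof -
    have "card L ^ 2 = (CARD('a) ^ N) ^ 2"
      using card_lagrangian[OF V(1) that] V(2) by (simp add: power_mult power2_eq_square power_mult_distrib)
    then have "card L = CARD('a) ^ N" by simp
    then show ?thesis using lagrangianD(1)[OF that] by (simp add: Int_absorb2)
  qed
  then have "{L. lagrangian (osum V {0}) L \<and> card (L \<inter> V) = CARD('a) ^ N} = {L. lagrangian V L}"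
    by (auto simp: V0)
  then show ?thesis
    using card_lagrangian_type[OF p, of N 0 0] V(2) by (simp add: isotropic_factor_def frame_count_def)
qed

lemma sum_card_lagrangian_type:
  assumes p: "symplectic_pair U U'"
    and c: "card U = CARD('a) ^ (2 * m)" "card U' = CARD('a) ^ (2 * m')"
  shows "(\<Sum>k = 0..m. card {L. lagrangian (osum U U') L \<and> card (L \<inter> U) = CARD('a) ^ k}) =
    card {L. lagrangian (osum U U') L}"
proof -
  let ?T = "\<lambda>k. {L. lagrangian (osum U U') L \<and> card (L \<inter> U) = CARD('a) ^ k}"
  have "{L. lagrangian (osum U U') L} = (\<Union>k\<in>{0..m}. ?T k)"
  proof (intro equalityI subsetI)
    fix L assume "L \<in> {L. lagrangian (osum U U') L}"
    then have L: "lagrangian (osum U U') L" by simp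
    then obtain k where k: "card (L \<inter> U) = CARD('a) ^ k" using lagrangian_shape[OF p] by blast
    then show "L \<in> (\<Union>k\<in>{0..m}. ?T k)" using lagrangian_shape_unique(1)[OF p L c k] L by auto
  qed auto
  then show ?thesis
    using card_scalar_gt_1 by (simp only:) (subst card_UN_disjoint, auto)
qed

subsection \<open>Isometries\<close>

text \<open>The coordinates of \<open>v\<close> in the frame \<open>B\<close>, put on the frame
  \<open>B'\<close>. Coordinates are pairings, so the map is linear on the whole space and kills
  everything orthogonal to \<open>B\<close>; maps on orthogonal summands can simply be
  added.\<close>

fun expand :: "('z \<times> 'z) list \<Rightarrow> ('z \<times> 'z) list \<Rightarrow> 'z \<Rightarrow> 'z" where
  "expand (p # B) (p' # B') v = s (b v (snd p)) (fst p') + (s (b v (fst p)) (snd p') + expand B B' v)"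
| "expand _ _ v = 0"

lemma expand_add: "expand B B' (v + w) = expand B B' v + expand B B' w"
  by (induction B B' v rule: expand.induct) (auto simp: scale_left_distrib ac_simps)

lemma expand_scale: "expand B B' (s c v) = s c (expand B B' v)"
  by (induction B B' v rule: expand.induct) (auto simp: scale_right_distrib)

lemma expand_orthogonal:
  "(\<And>p. p \<in> set B \<Longrightarrow> b v (fst p) = 0 \<and> b v (snd p) = 0) \<Longrightarrow> expand B B' v = 0"
  by (induction B B' v rule: expand.induct) auto

lemma expand_orthogonal_frame:
  assumes "frame U B" "\<And>u. u \<in> U \<Longrightarrow> b v u = 0"
  shows "expand B B' v = 0"
  using frame_subset[OF assms(1)] assms(2) by (intro expand_orthogonal) auto

lemma expand_mem:
  "subspace U \<Longrightarrow> (\<And>p. p \<in> set B' \<Longrightarrow> fst p \<in> U \<and> snd p \<in> U) \<Longrightarrow> expand B B' v \<in> U"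
  by (induction B B' v rule: expand.induct) (auto intro!: subspace_add subspace_scale simp: subspace_0)

lemma expand_Cons_cut:
  assumes "symplectic U" "frame U (p # B)" "w \<in> cut (fst p) (snd p) U"
  shows "expand (p # B) (p' # B') (s c (fst p) + (s d (snd p) + w)) = s c (fst p') + (s d (snd p') + expand B B' w)"
proof -
  let ?x = "fst p" and ?y = "snd p"
  have p: "?x \<in> U" "?y \<in> U" "b ?x ?y = 1" and B: "frame (cut ?x ?y U) B" using assms(2) by auto
  have 0: "expand B B' ?x = 0" "expand B B' ?y = 0"
    by (rule expand_orthogonal_frame[OF B], auto simp: cut_def)+
  have w: "b w ?x = 0" "b w ?y = 0" using assms(3) by (auto simp: cut_def form_commute[of w])
  show ?thesis
    using p w 0 symplecticD(2)[OF assms(1)] by (simp add: expand_add expand_scale form_commute[of ?y ?x])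
qed

lemma expand_self:
  assumes "symplectic U" "frame U B" "v \<in> U"
  shows "expand B B v = v"
  using assms
proof (induction B arbitrary: U v)
  case (Cons p B)
  have p: "fst p \<in> U" "snd p \<in> U" "b (fst p) (snd p) = 1" and B: "frame (cut (fst p) (snd p) U) B"
    using Cons.prems(2) by auto
  obtain w where w: "w \<in> cut (fst p) (snd p) U"
    "v = s (b v (snd p)) (fst p) + (s (b v (fst p)) (snd p) + w)"
    using hyperbolic_decomposition[OF symplecticD(1)[OF Cons.prems(1)] p _ _ Cons.prems(3)]
      symplecticD(2)[OF Cons.prems(1)] p by auto
  show ?case
    using expand_Cons_cut[OF Cons.prems(1,2) w(1), of p B] Cons.IH[OF symplectic_cut[OF Cons.prems(1) p] B w(1)] w(2)
    by metis
qed auto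

text \<open>The form of two images depends only on their coordinates and on the target being a
  frame, so replacing the target \<open>B'\<close> by \<open>B\<close> changes nothing; on
  \<open>U\<close> that replacement is the identity.\<close>

lemma expand_form:
  assumes "symplectic U" "frame U B" "frame U B'" "length B = length B'" "v \<in> U" "w \<in> U"
  shows "b (expand B B' v) (expand B B' w) = b v w"
proof -
  \<comment> \<open>Two ambient spaces are needed for the induction, since after one pair the frames
    \<open>B\<close> and \<open>B'\<close> live in different cuts; \<open>v\<close> and
    \<open>w\<close> are unrestricted for the same reason.\<close>
  have "b (expand B B' v) (expand B B' w) = b (expand B B v) (expand B B w)"
    if "length B = length B'" "symplectic U" "frame U B" "symplectic U'" "frame U' B'" for U U' B B' v w
    using that
  proof (induction B B' arbitrary: U U' rule: list_induct2)
    case (Cons p B p' B')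
    have p: "fst p \<in> U" "snd p \<in> U" "b (fst p) (snd p) = 1" and B: "frame (cut (fst p) (snd p) U) B"
      using Cons.prems(2) by auto
    have p': "fst p' \<in> U'" "snd p' \<in> U'" "b (fst p') (snd p') = 1" and B': "frame (cut (fst p') (snd p') U') B'"
      using Cons.prems(4) by auto
    have IH: "b (expand B B' v) (expand B B' w) = b (expand B B v) (expand B B w)"
      using Cons.IH[OF symplectic_cut[OF Cons.prems(1) p] B symplectic_cut[OF Cons.prems(3) p'] B'] .
    have "expand B B u \<in> cut (fst p) (snd p) U" for u
      by (rule expand_mem[OF subspace_cut[OF symplecticD(1)[OF Cons.prems(1)]]]) (use frame_subset[OF B] in auto)
    then have 1: "b (fst p) (expand B B u) = 0" "b (snd p) (expand B B u) = 0"
      "b (expand B B u) (fst p) = 0" "b (expand B B u) (snd p) = 0" for u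
      by (auto simp: cut_def form_commute[of "expand B B u"])
    have "expand B B' u \<in> cut (fst p') (snd p') U'" for u
      by (rule expand_mem[OF subspace_cut[OF symplecticD(1)[OF Cons.prems(3)]]]) (use frame_subset[OF B'] in auto)
    then have 2: "b (fst p') (expand B B' u) = 0" "b (snd p') (expand B B' u) = 0"
      "b (expand B B' u) (fst p') = 0" "b (expand B B' u) (snd p') = 0" for u
      by (auto simp: cut_def form_commute[of "expand B B' u"])
    show ?case
      using p p' symplecticD(2)[OF Cons.prems(1)] symplecticD(2)[OF Cons.prems(3)]
      by (simp add: 1 2 IH form_commute[of "snd p" "fst p"] form_commute[of "snd p'" "fst p'"])
  qed auto
  from this[OF assms(4,1,2,1,3)] show ?thesis using expand_self[OF assms(1,2)] assms(5,6) by simp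
qed

lemma map_expand_frame:
  assumes "length B = length B'" "symplectic U" "frame U B"
  shows "map (map_prod (expand B B') (expand B B')) B = B'"
  using assms
proof (induction B B' arbitrary: U rule: list_induct2)
  case (Cons p B p' B')
  let ?U = "cut (fst p) (snd p) U"
  have p: "fst p \<in> U" "snd p \<in> U" "b (fst p) (snd p) = 1" and B: "frame ?U B"
    using Cons.prems(2) by auto
  have U: "symplectic ?U" using symplectic_cut[OF Cons.prems(1) p] .
  have 0: "0 \<in> ?U" using subspace_0[OF symplecticD(1)[OF U]] .
  note ex = expand_Cons_cut[OF Cons.prems, of _ p' B']
  have "expand (p # B) (p' # B') (fst p) = fst p'" "expand (p # B) (p' # B') (snd p) = snd p'"
    using ex[OF 0, of 1 0] ex[OF 0, of 0 1] expand_orthogonal[of B 0 B'] by auto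
  moreover have "expand (p # B) (p' # B') w = expand B B' w" if "w \<in> ?U" for w
    using ex[OF that, of 0 0] by simp
  then have "map (map_prod (expand (p # B) (p' # B')) (expand (p # B) (p' # B'))) B
      = map (map_prod (expand B B') (expand B B')) B"
    using frame_subset[OF B] by (intro map_cong refl) (auto simp: prod_eq_iff)
  ultimately show ?case using Cons.IH[OF U B] by (simp add: prod_eq_iff del: expand.simps)
qed simp

context
  fixes f
  assumes f: "f \<in> isometries s b"
begin

lemma isometryD:
  shows isometry_add: "f (v + w) = f v + f w"
    and isometry_scale: "f (s c v) = s c (f v)"
    and isometry_form: "b (f v) (f w) = b v w"
    and isometry_zero: "f 0 = 0"
    and isometry_inj: "inj f"
proof -
  have lin: "Vector_Spaces.linear s s f" and "bij f" using f by (auto simp: isometries_def)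
  then show "inj f" by (simp add: bij_def)
  show "f (v + w) = f v + f w" "f (s c v) = s c (f v)" for v w c
    using lin by (auto simp: Vector_Spaces.linear_def module_hom_def module_hom_axioms_def)
  from this(2)[of 0 0] show "f 0 = 0" by simp
  show "b (f v) (f w) = b v w" using f by (simp add: isometries_def)
qed

lemma image_cut: "f ` cut x y U = cut (f x) (f y) (f ` U)"
  by (auto simp: cut_def isometry_form)

lemma image_adjoin: "f ` adjoin x L = adjoin (f x) (f ` L)"
proof (intro equalityI subsetI)
  fix v assume "v \<in> f ` adjoin x L"
  then obtain c l where "v = f (s c x + l)" "l \<in> L" by (auto simp: adjoin_def)
  then show "v \<in> adjoin (f x) (f ` L)" using adjoinI[of "f l"] by (simp add: isometry_add isometry_scale)
next
  fix v assume "v \<in> adjoin (f x) (f ` L)"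
  then obtain c l where "v = s c (f x) + f l" "l \<in> L" by (auto simp: adjoin_def)
  then have "v = f (s c x + l)" by (simp add: isometry_add isometry_scale)
  then show "v \<in> f ` adjoin x L" using adjoinI[OF \<open>l \<in> L\<close>] by blast
qed

lemma image_osum: "f ` osum V V' = osum (f ` V) (f ` V')"
proof (intro equalityI subsetI)
  fix v assume "v \<in> osum (f ` V) (f ` V')"
  then obtain u u' where "v = f u + f u'" "u \<in> V" "u' \<in> V'" by (auto elim!: osumE)
  then have "v = f (u + u')" "u + u' \<in> osum V V'" by (auto simp: isometry_add intro: osumI)
  then show "v \<in> f ` osum V V'" by blast
qed (auto simp: isometry_add intro!: osumI elim!: osumE)

lemma frame_image:
  "frame U B \<Longrightarrow> frame (f ` U) (map (map_prod f f) B)"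
  by (induction B arbitrary: U) (auto simp: isometry_zero isometry_form simp flip: image_cut)

lemma image_frame_lagrangian:
  "f ` frame_lagrangian k k' B B' = frame_lagrangian k k' (map (map_prod f f) B) (map (map_prod f f) B')"
  by (induction k k' B B' rule: frame_lagrangian.induct) (auto simp: isometry_zero image_adjoin isometry_add)

lemma isometry_expand: "f (expand B B' v) = expand B (map (map_prod f f) B') v"
  by (induction B B' v rule: expand.induct) (auto simp: isometry_zero isometry_add isometry_scale)

end

end

subsection \<open>The orthogonal sum of two odd-dimensional spaces\<close>

text \<open>The summands are orthogonal subspaces of one space rather than factors of a product, so
  the two sides obey the same axioms with roles exchanged. Odd dimension enters only through the
  unit vectors \<open>e\<close> and \<open>e'\<close>.\<close>

locale odd_pair = char2_form s b
  for s :: "'a::{field,finite} \<Rightarrow> 'z::ab_group_add \<Rightarrow> 'z" and b :: "'z \<Rightarrow> 'z \<Rightarrow> 'a" +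
  fixes W W' :: "'z set" and e e' :: 'z
  assumes nondegenerate: "nondegenerate_form b"
    and subspaces: "subspace W" "subspace W'"
    and spanning: "osum W W' = UNIV"
    and orthogonal: "\<And>w w'. w \<in> W \<Longrightarrow> w' \<in> W' \<Longrightarrow> b w w' = 0"
    and unit_mem: "e \<in> W" "e' \<in> W'"
    and unit_norm: "b e e = 1" "b e' e' = 1"
    and square: "\<And>w. w \<in> W \<Longrightarrow> b w w = (b w e)\<^sup>2" "\<And>w. w \<in> W' \<Longrightarrow> b w w = (b w e')\<^sup>2"
begin

definition U :: "'z set" where "U = {w \<in> W. b w e = 0}"
definition U' :: "'z set" where "U' = {w \<in> W'. b w e' = 0}"

definition isometry_group :: "('z \<Rightarrow> 'z) set" where
  "isometry_group = {f \<in> isometries s b. f ` W \<subseteq> W \<and> f ` W' \<subseteq> W'}"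

lemma swap: "odd_pair s b W' W e' e"
proof unfold_locales
  show "osum W' W = UNIV" using spanning osum_commute by metis
  show "b w w' = 0" if "w \<in> W'" "w' \<in> W" for w w'
    using orthogonal[OF that(2,1)] by (simp only: form_commute[of w w'])
qed (simp_all add: nondegenerate subspaces unit_mem unit_norm square)

lemma orthogonal': "w \<in> W \<Longrightarrow> w' \<in> W' \<Longrightarrow> b w' w = 0"
  using orthogonal form_commute by metis

lemma nondegD: "(\<And>w. b v w = 0) \<Longrightarrow> v = 0"
  using nondegenerate by (auto simp: nondegenerate_form_def)

lemma decompose:
  obtains w w' where "v = w + w'" "w \<in> W" "w' \<in> W'"
  using spanning osumE[of v W W'] by auto

text \<open>Since \<open>e\<close> has norm 1, \<open>W\<close> is the orthogonal sum of
  \<open>U\<close> and the line of \<open>e\<close>. A vector of \<open>U\<close> orthogonal to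
  \<open>U\<close> is thus orthogonal to \<open>W\<close>, and to \<open>W'\<close> as well.\<close>

lemma symplectic_U: "symplectic U"
  unfolding symplectic_def
proof (intro conjI ballI impI)
  show "subspace U" using subspaces(1) by (auto simp: U_def subspace_def)
  show "b u u = 0" if "u \<in> U" for u using that square(1)[of u] by (simp add: U_def)
  fix u assume u: "u \<in> U" "\<forall>v\<in>U. b u v = 0"
  show "u = 0"
  proof (rule nondegD)
    fix v obtain w w' where v: "v = w + w'" "w \<in> W" "w' \<in> W'" by (rule decompose)
    have "w + s (b w e) e \<in> U"
      using v(2) unit_mem unit_norm subspaces by (auto simp: U_def intro!: subspace_add subspace_scale)
    then have "b u (w + s (b w e) e) = 0" using u by blast
    then have "b u w = 0" using u(1) by (simp add: U_def)
    moreover have "b u w' = 0" using u(1) orthogonal v(3) by (auto simp: U_def)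
    ultimately show "b u v = 0" by (simp add: v)
  qed
qed

lemma symplectic_pair_U: "symplectic_pair U U'"
proof -
  interpret sw: odd_pair s b W' W e' e by (rule swap)
  have "sw.U = U'" by (simp add: sw.U_def U'_def)
  then show ?thesis
    using symplectic_U sw.symplectic_U orthogonal by (auto simp: symplectic_pair_def U_def U'_def)
qed

lemma osum_U: "osum U U' = {v. b v e = 0 \<and> b v e' = 0}"
proof (intro equalityI subsetI)
  fix v assume v: "v \<in> {v. b v e = 0 \<and> b v e' = 0}"
  obtain w w' where w: "v = w + w'" "w \<in> W" "w' \<in> W'" by (rule decompose)
  have "w \<in> U" "w' \<in> U'"
    using v w orthogonal orthogonal' unit_mem by (auto simp: U_def U'_def)
  then show "v \<in> osum U U'" using w osumI by blast
next
  fix v assume "v \<in> osum U U'"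
  then show "v \<in> {v. b v e = 0 \<and> b v e' = 0}"
    using orthogonal orthogonal' unit_mem by (auto simp: U_def U'_def elim!: osumE)
qed

lemma unit_orthogonal [simp]: "b e e' = 0" "b e' e = 0"
  using orthogonal orthogonal' unit_mem by auto

lemma U_orthogonal:
  shows "u \<in> U \<Longrightarrow> b u e = 0" "u \<in> U \<Longrightarrow> b u e' = 0" "u \<in> U \<Longrightarrow> b e u = 0" "u \<in> U \<Longrightarrow> b e' u = 0"
    and "u' \<in> U' \<Longrightarrow> b u' e = 0" "u' \<in> U' \<Longrightarrow> b u' e' = 0" "u' \<in> U' \<Longrightarrow> b e u' = 0" "u' \<in> U' \<Longrightarrow> b e' u' = 0"
    and "u \<in> U \<Longrightarrow> u' \<in> U' \<Longrightarrow> b u u' = 0" "u \<in> U \<Longrightarrow> u' \<in> U' \<Longrightarrow> b u' u = 0"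
  using orthogonal orthogonal' unit_mem form_commute[of e u] form_commute[of e' u']
  by (auto simp: U_def U'_def)

text \<open>The vector representing the square root of the norm on the sum is \<open>e + e'\<close>,
  because squaring is additive.\<close>

lemma norm_unit: "b v v = (b v (e + e'))\<^sup>2"
proof -
  obtain w w' where w: "v = w + w'" "w \<in> W" "w' \<in> W'" by (rule decompose)
  have "b v v = b w w + b w' w'" using w orthogonal orthogonal' by simp
  also have "\<dots> = (b w e)\<^sup>2 + (b w' e')\<^sup>2" using square w by simp
  also have "\<dots> = (b w e + b w' e')\<^sup>2" by (simp add: power2_eq_square distrib_left distrib_right ac_simps)
  also have "b w e + b w' e' = b v (e + e')" using w orthogonal orthogonal' unit_mem by simp
  finally show ?thesis .
qed

text \<open>Isotropic vectors are orthogonal to \<open>e + e'\<close>, which therefore belongs to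
  the self-orthogonal \<open>S\<close>. Every \<open>l\<close> in \<open>S\<close> then satisfies
  \<open>b l e = b l e'\<close>, so one multiple of \<open>e + e'\<close> removes both unit
  components.\<close>

lemma lagrangian_UNIV:
  assumes S: "lagrangian UNIV S"
  shows "lagrangian (osum U U') (S \<inter> osum U U')" "S = adjoin (e + e') (S \<inter> osum U U')"
proof -
  have sS: "subspace S" using subspace_lagrangian[OF subspace_UNIV S] .
  have ee: "e + e' \<in> S"
  proof (rule lagrangianD(3)[OF S UNIV_I])
    fix l assume "l \<in> S"
    then have "b l l = 0" using lagrangianD(2)[OF S] by blast
    then have "b l (e + e') = 0" using norm_unit[of l] by simp
    then show "b (e + e') l = 0" by (simp only: form_commute[of "e + e'" l])
  qed
  have orth: "b l e = b l e'" if "l \<in> S" for l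
    using lagrangianD(2)[OF S that ee] by simp
  have proj: "v + s (b v e) (e + e') \<in> osum U U'" if "b v e = b v e'" for v
    using that unit_norm by (simp add: osum_U)
  show S_eq: "S = adjoin (e + e') (S \<inter> osum U U')"
  proof (intro equalityI subsetI)
    fix v assume v: "v \<in> S"
    have "v + s (b v e) (e + e') \<in> S \<inter> osum U U'"
      using proj[OF orth[OF v]] v ee sS by (auto intro!: subspace_add subspace_scale)
    from adjoinI[OF this, of "b v e" "e + e'"] show "v \<in> adjoin (e + e') (S \<inter> osum U U')"
      by (simp only: add.left_commute vector_double add.commute[of _ 0] add_0)
  qed (use adjoin_subset[OF sS ee] in auto)
  show "lagrangian (osum U U') (S \<inter> osum U U')"
    unfolding lagrangian_def
  proof (intro conjI ballI iffI)
    fix v assume v: "v \<in> osum U U'" "\<forall>l\<in>S \<inter> osum U U'. b v l = 0"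
    have "v \<in> S"
    proof (rule lagrangianD(3)[OF S UNIV_I])
      fix l assume "l \<in> S"
      then obtain c m where l: "l = s c (e + e') + m" "m \<in> S \<inter> osum U U'" using S_eq adjoinE by metis
      have "b v m = 0" using l(2) v(2) by blast
      then show "b v l = 0" using l(1) v(1) by (simp add: osum_U)
    qed
    then show "v \<in> S \<inter> osum U U'" using v by blast
  qed (use lagrangianD(2)[OF S] in auto)
qed

text \<open>The inverse passage. Pairing with \<open>e\<close> or \<open>e'\<close> reads off the
  coefficient of \<open>e + e'\<close>; it vanishes for vectors of the symplectic sum and for
  vectors of \<open>W\<close>, which gives the two intersections.\<close>

lemma lagrangian_adjoin_unit:
  assumes L: "lagrangian (osum U U') L"
  shows "lagrangian UNIV (adjoin (e + e') L)" "adjoin (e + e') L \<inter> osum U U' = L"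
    "adjoin (e + e') L \<inter> W = L \<inter> U"
proof -
  have sL: "subspace L"
    using subspace_lagrangian[OF symplecticD(1)[OF symplectic_osum[OF symplectic_pair_U]] L] .
  have L0: "b l e = 0" "b l e' = 0" "b e l = 0" "b e' l = 0" if "l \<in> L" for l
    using that lagrangianD(1)[OF L] form_commute[of e l] form_commute[of e' l] by (auto simp: osum_U)
  show "lagrangian UNIV (adjoin (e + e') L)"
    unfolding lagrangian_def
  proof (intro conjI ballI iffI)
    fix v l assume "v \<in> adjoin (e + e') L" "l \<in> adjoin (e + e') L"
    then obtain c k d m where "v = s c (e + e') + k" "k \<in> L" "l = s d (e + e') + m" "m \<in> L"
      by (metis adjoinE)
    then show "b v l = 0" using L0 unit_norm lagrangianD(2)[OF L] by simp
  next
    fix v assume v: "\<forall>l\<in>adjoin (e + e') L. b v l = 0"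
    have "b v (e + e') = 0" using v mem_adjoin_self[OF sL] by blast
    then have eq: "b v e = b v e'" by simp
    have "v + s (b v e) (e + e') \<in> L"
    proof (rule lagrangianD(3)[OF L])
      show "v + s (b v e) (e + e') \<in> osum U U'" using eq unit_norm by (simp add: osum_U)
      fix l assume l: "l \<in> L"
      then have "b v l = 0" using v adjoin_superset by blast
      then show "b (v + s (b v e) (e + e')) l = 0" using L0[OF l] by simp
    qed
    from adjoinI[OF this, of "b v e" "e + e'"] show "v \<in> adjoin (e + e') L"
      by (simp only: add.left_commute vector_double add.commute[of _ 0] add_0)
  qed simp
  show *: "adjoin (e + e') L \<inter> osum U U' = L"
  proof (intro equalityI subsetI)
    fix v assume v: "v \<in> adjoin (e + e') L \<inter> osum U U'"
    then obtain c l where l: "v = s c (e + e') + l" "l \<in> L" by (blast elim: adjoinE)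
    have "b v e = c" using l L0 unit_norm by simp
    then show "v \<in> L" using l v by (simp add: osum_U)
  qed (use adjoin_superset lagrangianD(1)[OF L] in auto)
  show "adjoin (e + e') L \<inter> W = L \<inter> U"
  proof (intro equalityI subsetI)
    fix v assume v: "v \<in> adjoin (e + e') L \<inter> W"
    then obtain c l where l: "v = s c (e + e') + l" "l \<in> L" by (blast elim: adjoinE)
    have "b v e' = c" using l L0 unit_norm by simp
    then have "c = 0" using orthogonal[of v e'] v unit_mem(2) by (metis Int_iff)
    then have "v = l" using l(1) by simp
    then have "v \<in> L" "v \<in> W" using l(2) v by (simp_all only: Int_iff)
    then show "v \<in> L \<inter> U" using L0(1) by (simp add: U_def)
  qed (use adjoin_superset in \<open>auto simp: U_def\<close>)
qed

text \<open>The form on \<open>W\<close> alone determines \<open>e\<close>: if w = f u, then u and w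
  have the same norm, so their pairings with \<open>e\<close> have equal squares and are
  equal.\<close>

lemma group_fixes_unit:
  assumes "f \<in> isometry_group"
  shows "f e = e"
proof -
  have f: "f \<in> isometries s b" and fW: "f ` W \<subseteq> W" "f ` W' \<subseteq> W'"
    using assms by (auto simp: isometry_group_def)
  have W: "f ` W = W"
    by (rule card_subset_eq[OF finite_vec fW(1)]) (rule card_image[OF inj_on_subset[OF isometry_inj[OF f] subset_UNIV]])
  have "f e + e = 0"
  proof (rule nondegD)
    fix v obtain w w' where v: "v = w + w'" "w \<in> W" "w' \<in> W'" by (rule decompose)
    obtain u where u: "w = f u" "u \<in> W" using v W by blast
    have "(b u e)\<^sup>2 = (b w e)\<^sup>2"
      using square(1)[OF v(2)] square(1)[OF u(2)] isometry_form[OF f, of u u] u by simp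
    then have "(b u e + b w e)\<^sup>2 = 0" by (simp add: power2_eq_square distrib_left distrib_right ac_simps)
    then have "b u e = b w e" by simp
    moreover have "b (f e) w = b e u" using isometry_form[OF f, of e u] u by simp
    ultimately have "b (f e) w = b e w" by (simp add: form_commute[of e u] form_commute[of e w])
    moreover have "b (f e) w' = 0" "b e w' = 0" using orthogonal v fW(1) unit_mem by blast+
    ultimately show "b (f e + e) v = 0" by (simp add: v)
  qed
  then show ?thesis by (metis vector_double(1) add_right_cancel)
qed

lemma group_image_U:
  assumes "f \<in> isometry_group"
  shows "f ` U = U"
proof -
  have f: "f \<in> isometries s b" and fW: "f ` W \<subseteq> W"
    using assms by (auto simp: isometry_group_def)
  have "f ` U \<subseteq> U"
    using fW isometry_form[OF f, of _ e] group_fixes_unit[OF assms] by (auto simp: U_def)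
  then show ?thesis
    by (rule card_subset_eq[OF finite_vec]) (rule card_image[OF inj_on_subset[OF isometry_inj[OF f] subset_UNIV]])
qed

lemma group_swap:
  assumes "f \<in> isometry_group"
  shows "f e' = e'" "f ` U' = U'"
proof -
  interpret sw: odd_pair s b W' W e' e by (rule swap)
  have "f \<in> sw.isometry_group" using assms by (auto simp: isometry_group_def sw.isometry_group_def)
  then show "f e' = e'" "f ` U' = U'"
    using sw.group_fixes_unit sw.group_image_U by (auto simp: sw.U_def U'_def)
qed

text \<open>The group element that fixes \<open>e\<close> and \<open>e'\<close> and carries the pair
  of frames \<open>(B, B')\<close> to \<open>(C, C')\<close>.\<close>

definition frame_map :: "('z \<times> 'z) list \<Rightarrow> ('z \<times> 'z) list \<Rightarrow> ('z \<times> 'z) list \<Rightarrow> ('z \<times> 'z) list \<Rightarrow> 'z \<Rightarrow> 'z" where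
  "frame_map B B' C C' v = s (b v e) e + (s (b v e') e' + (expand B C v + expand B' C' v))"

lemma unit_decompose:
  obtains u u' where "v = s (b v e) e + (s (b v e') e' + (u + u'))" "u \<in> U" "u' \<in> U'"
proof -
  have "v + (s (b v e) e + s (b v e') e') \<in> osum U U'" using unit_norm by (simp add: osum_U)
  then obtain u u' where u: "v + (s (b v e) e + s (b v e') e') = u + u'" "u \<in> U" "u' \<in> U'" by (rule osumE)
  have "v = s (b v e) e + (s (b v e') e' + (v + (s (b v e) e + s (b v e') e')))" by (simp add: ac_simps)
  then have "v = s (b v e) e + (s (b v e') e' + (u + u'))" by (simp only: u(1))
  then show ?thesis using that u by blast
qed

lemma frame_map_decomposed:
  assumes B: "frame U B" "frame U' B'" and u: "u \<in> U" "u' \<in> U'"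
  shows "frame_map B B' C C' (s c e + (s d e' + (u + u'))) = s c e + (s d e' + (expand B C u + expand B' C' u'))"
proof -
  have 0: "expand B C e = 0" "expand B C e' = 0" "expand B C u' = 0"
    "expand B' C' e = 0" "expand B' C' e' = 0" "expand B' C' u = 0"
    using u by (auto intro!: expand_orthogonal_frame[OF B(1)] expand_orthogonal_frame[OF B(2)] simp: U_orthogonal)
  show ?thesis
    using unit_norm u by (simp add: frame_map_def expand_add expand_scale 0 U_orthogonal)
qed

lemma frame_map_group:
  assumes B: "frame U B" "frame U' B'" and C: "frame U C" "frame U' C'"
  shows "frame_map B B' C C' \<in> isometry_group"
    and "map (map_prod (frame_map B B' C C') (frame_map B B' C C')) B = C"
    and "map (map_prod (frame_map B B' C C') (frame_map B B' C C')) B' = C'"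
proof -
  let ?f = "frame_map B B' C C'"
  note p = symplectic_pairD(1,2)[OF symplectic_pair_U]
  have len: "length B = length C" "length B' = length C'"
    using frame_length_eq[OF p(1) B(1)] frame_length_eq[OF p(2) B(2)]
      frame_length[OF p(1) C(1)] frame_length[OF p(2) C(2)] by auto
  have exU: "expand B C v \<in> U" "expand B' C' v \<in> U'" for v
    using expand_mem[OF symplecticD(1)[OF p(1)] frame_subset[OF C(1)]]
      expand_mem[OF symplecticD(1)[OF p(2)] frame_subset[OF C(2)]] by blast+
  have add: "?f (v + w) = ?f v + ?f w" for v w
    by (simp add: frame_map_def expand_add scale_left_distrib ac_simps)
  have scale: "?f (s c v) = s c (?f v)" for c v
    by (simp add: frame_map_def expand_scale scale_right_distrib)
  have form: "b (?f v) (?f w) = b v w" for v w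
  proof -
    obtain u1 u1' where v: "v = s (b v e) e + (s (b v e') e' + (u1 + u1'))" and u1: "u1 \<in> U" "u1' \<in> U'"
      by (rule unit_decompose)
    obtain u2 u2' where w: "w = s (b w e) e + (s (b w e') e' + (u2 + u2'))" and u2: "u2 \<in> U" "u2' \<in> U'"
      by (rule unit_decompose)
    have key: "b (s c e + (s d e' + (x + y))) (s c' e + (s d' e' + (x' + y'))) = c * c' + d * d' + b x x' + b y y'"
      if "x \<in> U" "y \<in> U'" "x' \<in> U" "y' \<in> U'" for c d c' d' x y x' y'
      using that unit_norm by (simp add: U_orthogonal ac_simps)
    have fv: "?f v = s (b v e) e + (s (b v e') e' + (expand B C u1 + expand B' C' u1'))"
      by (subst v) (rule frame_map_decomposed[OF B u1])
    have fw: "?f w = s (b w e) e + (s (b w e') e' + (expand B C u2 + expand B' C' u2'))"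
      by (subst w) (rule frame_map_decomposed[OF B u2])
    have "b (?f v) (?f w) = b v e * b w e + b v e' * b w e' + b u1 u2 + b u1' u2'"
      unfolding fv fw by (simp only: key[OF exU exU] expand_form[OF p(1) B(1) C(1) len(1) u1(1) u2(1)]
          expand_form[OF p(2) B(2) C(2) len(2) u1(2) u2(2)])
    also have "\<dots> = b (s (b v e) e + (s (b v e') e' + (u1 + u1'))) (s (b w e) e + (s (b w e') e' + (u2 + u2')))"
      by (simp only: key[OF u1 u2])
    finally show ?thesis by (simp only: v[symmetric] w[symmetric])
  qed
  have "inj ?f"
  proof (rule injI)
    fix v w assume eq: "?f v = ?f w"
    have "v + w = 0"
    proof (rule nondegD)
      fix z
      have "b (v + w) z = b (?f (v + w)) (?f z)" by (simp only: form)
      also have "\<dots> = 0" by (simp add: add eq)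
      finally show "b (v + w) z = 0" .
    qed
    then show "v = w" by (metis vector_double(1) add_right_cancel)
  qed
  then have "bij ?f" using finite_UNIV_inj_surj[OF finite_vec] by (simp add: bij_def)
  then have iso: "?f \<in> isometries s b"
    using add scale form vector_space_axioms module_axioms
    by (auto simp: isometries_def Vector_Spaces.linear_def module_hom_def module_hom_axioms_def)
  have "?f v \<in> W" if "v \<in> W" for v
  proof -
    have "expand B' C' v = 0" "b v e' = 0"
      using that orthogonal unit_mem by (auto intro!: expand_orthogonal_frame[OF B(2)] simp: U'_def)
    then show ?thesis
      using exU(1)[of v] unit_mem subspaces by (auto simp: frame_map_def U_def intro!: subspace_add subspace_scale)
  qed
  moreover have "?f v \<in> W'" if "v \<in> W'" for v
  proof -
    have "expand B C v = 0" "b v e = 0"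
      using that orthogonal' unit_mem by (auto intro!: expand_orthogonal_frame[OF B(1)] simp: U_def)
    then show ?thesis
      using exU(2)[of v] unit_mem subspaces by (auto simp: frame_map_def U'_def intro!: subspace_add subspace_scale)
  qed
  ultimately show "?f \<in> isometry_group" using iso by (auto simp: isometry_group_def)
  have "?f u = expand B C u" if "u \<in> U" for u
    using frame_map_decomposed[OF B that subspace_0[OF symplecticD(1)[OF p(2)]], of C C' 0 0] expand_orthogonal[of B' 0 C'] by simp
  then have "map (map_prod ?f ?f) B = map (map_prod (expand B C) (expand B C)) B"
    using frame_subset[OF B(1)] by (intro map_cong refl) (auto simp: prod_eq_iff)
  then show "map (map_prod ?f ?f) B = C" using map_expand_frame[OF len(1) p(1) B(1)] by simp
  have "?f u = expand B' C' u" if "u \<in> U'" for u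
    using frame_map_decomposed[OF B subspace_0[OF symplecticD(1)[OF p(1)]] that, of C C' 0 0] expand_orthogonal[of B 0 C] by simp
  then have "map (map_prod ?f ?f) B' = map (map_prod (expand B' C') (expand B' C')) B'"
    using frame_subset[OF B(2)] by (intro map_cong refl) (auto simp: prod_eq_iff)
  then show "map (map_prod ?f ?f) B' = C'" using map_expand_frame[OF len(2) p(2) B(2)] by simp
qed

text \<open>An element is determined by the image of a single pair of frames. With the existence of
  \<open>frame_map\<close> this says that the group acts simply transitively on pairs of
  frames.\<close>

lemma group_eq_frame_map:
  assumes B: "frame U B" "frame U' B'" and f: "f \<in> isometry_group"
  shows "f = frame_map B B' (map (map_prod f f) B) (map (map_prod f f) B')"
proof
  fix v
  have iso: "f \<in> isometries s b" using f by (simp add: isometry_group_def)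
  obtain u u' where v: "v = s (b v e) e + (s (b v e') e' + (u + u'))" and u: "u \<in> U" "u' \<in> U'"
    by (rule unit_decompose)
  note p = symplectic_pairD(1,2)[OF symplectic_pair_U]
  have "f v = f (s (b v e) e + (s (b v e') e' + (expand B B u + expand B' B' u')))"
    by (subst v) (simp only: expand_self[OF p(1) B(1) u(1)] expand_self[OF p(2) B(2) u(2)])
  also have "\<dots> = s (b v e) e + (s (b v e') e' +
      (expand B (map (map_prod f f) B) u + expand B' (map (map_prod f f) B') u'))"
    by (simp only: isometry_add[OF iso] isometry_scale[OF iso] isometry_expand[OF iso]
        group_fixes_unit[OF f] group_swap(1)[OF f])
  also have "\<dots> = frame_map B B' (map (map_prod f f) B) (map (map_prod f f) B') v"
    by (subst (3) v) (rule frame_map_decomposed[OF B u, symmetric])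
  finally show "f v = frame_map B B' (map (map_prod f f) B) (map (map_prod f f) B') v" .
qed

lemma group_image_adjoin_unit:
  assumes "f \<in> isometry_group"
  shows "f ` adjoin (e + e') L = adjoin (e + e') (f ` L)"
proof -
  have iso: "f \<in> isometries s b" using assms by (simp add: isometry_group_def)
  show ?thesis
    by (simp add: image_adjoin[OF iso] isometry_add[OF iso] group_fixes_unit[OF assms] group_swap(1)[OF assms])
qed

lemma group_transitive:
  assumes S: "S = adjoin (e + e') (frame_lagrangian k k' B B')" "frame U B" "frame U' B'"
    and T: "T = adjoin (e + e') (frame_lagrangian k k' C C')" "frame U C" "frame U' C'"
  shows "\<exists>f\<in>isometry_group. f ` S = T"
proof
  let ?f = "frame_map B B' C C'"
  note fm = frame_map_group[OF S(2,3) T(2,3)]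
  show f: "?f \<in> isometry_group" by (rule fm)
  then have iso: "?f \<in> isometries s b" by (simp add: isometry_group_def)
  show "?f ` S = T"
    by (simp add: S(1) T(1) group_image_adjoin_unit[OF f] image_frame_lagrangian[OF iso] fm(2,3))
qed

text \<open>With a base pair adapted to \<open>L\<close>, the correspondence sends an element to the
  image of that pair. As \<open>frame_lagrangian\<close> commutes with isometries, the image is
  adapted to \<open>L\<close> exactly when \<open>L\<close> is preserved, and \<open>L\<close> is
  recovered from \<open>adjoin (e + e') L\<close> by intersecting with the invariant symplectic
  sum.\<close>

lemma card_stabilizer:
  assumes L: "lagrangian (osum U U') L" and B: "(B, B') \<in> adapted k k' U U' L"
  shows "card {f \<in> isometry_group. f ` adjoin (e + e') L = adjoin (e + e') L} = card (adapted k k' U U' L)"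
proof (rule bij_betw_same_card)
  have fr: "frame U B" "frame U' B'" and frame_lagrangian: "frame_lagrangian k k' B B' = L" using B by (auto simp: adapted_def)
  let ?S = "{f \<in> isometry_group. f ` adjoin (e + e') L = adjoin (e + e') L}"
  let ?h = "\<lambda>f. (map (map_prod f f) B, map (map_prod f f) B')"
  show "bij_betw ?h ?S (adapted k k' U U' L)"
  proof (rule bij_betw_byWitness[where f' = "\<lambda>(C, C'). frame_map B B' C C'"])
    show "\<forall>f\<in>?S. (\<lambda>(C, C'). frame_map B B' C C') (?h f) = f"
      using group_eq_frame_map[OF fr] by auto
    show "\<forall>z\<in>adapted k k' U U' L. ?h ((\<lambda>(C, C'). frame_map B B' C C') z) = z"
      using frame_map_group[OF fr] by (auto simp: adapted_def)
    show "?h ` ?S \<subseteq> adapted k k' U U' L"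
    proof clarify
      fix f assume f: "f \<in> isometry_group" and stab: "f ` adjoin (e + e') L = adjoin (e + e') L"
      have iso: "f \<in> isometries s b" using f by (simp add: isometry_group_def)
      have "f ` osum U U' = osum U U'"
        using image_osum[OF iso] group_image_U[OF f] group_swap(2)[OF f] by simp
      then have "f ` (adjoin (e + e') L \<inter> osum U U') = adjoin (e + e') L \<inter> osum U U'"
        by (simp add: image_Int[OF isometry_inj[OF iso]] stab)
      then have "f ` L = L" by (simp add: lagrangian_adjoin_unit(2)[OF L])
      then have "frame_lagrangian k k' (map (map_prod f f) B) (map (map_prod f f) B') = L"
        using image_frame_lagrangian[OF iso, of k k' B B'] frame_lagrangian by simp
      then show "?h f \<in> adapted k k' U U' L"
        using frame_image[OF iso fr(1)] frame_image[OF iso fr(2)] group_image_U[OF f] group_swap(2)[OF f]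
        by (simp add: adapted_def)
    qed
    show "(\<lambda>(C, C'). frame_map B B' C C') ` adapted k k' U U' L \<subseteq> ?S"
    proof clarify
      fix C C' assume "(C, C') \<in> adapted k k' U U' L"
      then have C: "frame U C" "frame U' C'" "frame_lagrangian k k' C C' = L" by (auto simp: adapted_def)
      note fm = frame_map_group[OF fr C(1,2)]
      have iso: "frame_map B B' C C' \<in> isometries s b" using fm(1) by (simp add: isometry_group_def)
      have "frame_map B B' C C' ` L = L"
        using image_frame_lagrangian[OF iso, of k k' B B'] fm C frame_lagrangian by simp
      then show "frame_map B B' C C' \<in> isometry_group \<and>
          frame_map B B' C C' ` adjoin (e + e') L = adjoin (e + e') L"
        using fm(1) by (simp add: group_image_adjoin_unit[OF fm(1)])
    qed
  qed
qed

end

section \<open>Dimension and cardinality; existence of the unit vector\<close>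

lemma card_span_independent:
  fixes s :: "'a::{field,finite} \<Rightarrow> 'v::ab_group_add \<Rightarrow> 'v"
  assumes "vector_space s" "finite B" "\<not> module.dependent s B"
  shows "finite (module.span s B)" "card (module.span s B) = CARD('a) ^ card B"
proof -
  interpret vector_space s by fact
  have "finite (span B) \<and> card (span B) = CARD('a) ^ card B"
    using assms(2,3)
  proof (induction B)
    case (insert a B)
    have ind: "independent B" "a \<notin> span B" using insert.hyps insert.prems by (simp_all add: independent_insert)
    have IH: "finite (span B)" "card (span B) = CARD('a) ^ card B" using insert.IH ind by auto
    let ?f = "\<lambda>(c, v). s c a + v"
    have "span (insert a B) = ?f ` (UNIV \<times> span B)"
    proof (intro equalityI subsetI)
      fix v assume "v \<in> span (insert a B)"
      then obtain c where "v - s c a \<in> span B" by (auto simp: span_insert)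
      then show "v \<in> ?f ` (UNIV \<times> span B)" by (intro image_eqI[of _ _ "(c, v - s c a)"]) auto
    next
      fix v assume "v \<in> ?f ` (UNIV \<times> span B)"
      then obtain c w where v: "v = s c a + w" "w \<in> span B" by auto
      then have "w \<in> span (insert a B)" using span_mono[of B "insert a B"] by blast
      then show "v \<in> span (insert a B)" unfolding v(1)
        by (simp add: span_add span_scale span_base)
    qed
    moreover have "inj_on ?f (UNIV \<times> span B)"
    proof (rule inj_onI, clarify)
      fix c v d w assume v: "v \<in> span B" and w: "w \<in> span B" and eq: "s c a + v = s d a + w"
      have "s (c - d) a = w - v" using eq by (simp add: algebra_simps)
      then have *: "s (c - d) a \<in> span B" using span_diff[OF w v] by simp
      have "c = d"
      proof (rule ccontr)
        assume "c \<noteq> d"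
        then have "a = s (1 / (c - d)) (s (c - d) a)" by simp
        then show False using ind(2) span_scale[OF *, of "1 / (c - d)"] by simp
      qed
      then show "c = d \<and> v = w" using eq by simp
    qed
    ultimately show ?case
      using IH insert.hyps by (simp add: card_image card_cartesian_product)
  qed simp
  then show "finite (module.span s B)" "card (module.span s B) = CARD('a) ^ card B" by auto
qed

lemma finite_UNIV_if_dim:
  fixes s :: "'a::{field,finite} \<Rightarrow> 'v::ab_group_add \<Rightarrow> 'v"
  assumes "vector_space s" "vector_space.dim s (UNIV :: 'v set) \<noteq> 0"
  shows "finite (UNIV :: 'v set)"
proof -
  interpret vector_space s by fact
  obtain B where B: "independent B" "UNIV \<subseteq> span B" "card B = dim (UNIV :: 'v set)"
    by (rule basis_exists[of UNIV])
  \<comment> \<open>An infinite basis would have cardinality 0 by convention, which the nonzero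
    dimension excludes.\<close>
  have "finite B" by (rule card_ge_0_finite) (use B(3) assms(2) in simp)
  moreover have "span B = UNIV" using B(2) by blast
  ultimately show ?thesis using card_span_independent(1)[OF assms(1) _ B(1)] by simp
qed

context char2_form
begin

lemma card_subspace:
  assumes "subspace S"
  shows "card S = CARD('a) ^ dim S"
proof -
  obtain B where B: "B \<subseteq> S" "independent B" "S \<subseteq> span B" "card B = dim S"
    by (rule basis_exists[of S])
  then have "span B = S" using span_minimal[OF B(1) assms] by blast
  then show ?thesis using card_span_independent(2)[OF vector_space_axioms finite_vec B(2)] B(4) by simp
qed

lemma squares_inj: "(c::'a)\<^sup>2 = d\<^sup>2 \<Longrightarrow> c = d"
proof -
  assume "c\<^sup>2 = d\<^sup>2"
  then have "(c + d)\<^sup>2 = 0" by (simp add: power2_eq_square distrib_left distrib_right ac_simps)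
  then show "c = d" by simp
qed

lemma unit_exists:
  assumes nondeg: "nondegenerate_form b" and odd: "odd (dim (UNIV :: 'z set))"
  obtains e where "b e e = 1" "\<And>v. b v v = (b v e)\<^sup>2"
proof -
  obtain B where B: "independent B" "UNIV \<subseteq> span B" "card B = dim (UNIV :: 'z set)"
    by (rule basis_exists[of UNIV])
  have nondegD: "(\<And>w. b v w = 0) \<Longrightarrow> v = 0" for v
    using nondeg by (auto simp: nondegenerate_form_def)
  \<comment> \<open>Restriction of the functional \<open>b _ e\<close> to a basis is injective by
    nondegeneracy. Domain and codomain have equal size, so every prescription of values on the basis
    is represented by some \<open>e\<close>.\<close>
  let ?h = "\<lambda>e. restrict (\<lambda>v. b v e) B"
  have "inj ?h"
  proof (rule injI)
    fix x y assume eq: "?h x = ?h y"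
    have "b v x = b v y" if "v \<in> B" for v using fun_cong[OF eq, of v] that by simp
    then have "B \<subseteq> {v. b v (x + y) = 0}" by auto
    moreover have "subspace {v. b v (x + y) = 0}" by (auto simp: subspace_def)
    ultimately have "span B \<subseteq> {v. b v (x + y) = 0}" by (rule span_minimal)
    then have "b (x + y) w = 0" for w using B(2) by (simp only: form_commute[of "x + y" w]) blast
    then have "x + y = 0" by (rule nondegD)
    then show "x = y" by (metis vector_double(1) add_right_cancel)
  qed
  then have "card (range ?h) = CARD('a) ^ card B"
    using card_subspace[OF subspace_UNIV] B(3) by (simp add: card_image)
  then have range: "range ?h = B \<rightarrow>\<^sub>E UNIV"
    by (intro card_subset_eq) (auto simp: finite_PiE card_PiE)
  \<comment> \<open>Frobenius is injective, hence bijective on the finite field, so each norm has a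
    square root.\<close>
  have "inj (\<lambda>c::'a. c\<^sup>2)" using squares_inj by (auto intro: injI)
  then have "surj (\<lambda>c::'a. c\<^sup>2)" by (simp add: finite_UNIV_inj_surj)
  then have "\<forall>v. \<exists>c. b v v = c\<^sup>2" by (meson surjD)
  then obtain r where r: "\<And>v. b v v = (r v)\<^sup>2" by metis
  have "restrict r B \<in> range ?h" by (simp only: range) auto
  then obtain e where "?h e = restrict r B" by auto
  then have "b v e = r v" if "v \<in> B" for v using that by (metis restrict_apply')
  then have "B \<subseteq> {v. b v v = (b v e)\<^sup>2}" using r by auto
  \<comment> \<open>Both sides are additive in \<open>v\<close>: the cross terms on the left occur
    twice and cancel. Hence agreement on a basis is enough.\<close>
  moreover have "subspace {v. b v v = (b v e)\<^sup>2}"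
    unfolding subspace_def
  proof (intro conjI ballI allI)
    fix v w assume "v \<in> {v. b v v = (b v e)\<^sup>2}" "w \<in> {v. b v v = (b v e)\<^sup>2}"
    then have vw: "b v v = (b v e)\<^sup>2" "b w w = (b w e)\<^sup>2" by auto
    have "b (v + w) (v + w) = b v v + b w w" by (simp add: form_commute[of w v] ac_simps)
    also have "\<dots> = (b (v + w) e)\<^sup>2"
      unfolding vw by (simp add: power2_eq_square distrib_left distrib_right ac_simps)
    finally show "v + w \<in> {v. b v v = (b v e)\<^sup>2}" by simp
  qed (auto simp: power2_eq_square ac_simps)
  ultimately have "span B \<subseteq> {v. b v v = (b v e)\<^sup>2}" by (rule span_minimal)
  then have e: "b v v = (b v e)\<^sup>2" for v using B(2) by blast
  have "b e e \<noteq> 0"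
  proof
    assume e0: "b e e = 0"
    \<comment> \<open>This form is alternating; if \<open>b e e = 0\<close> it is nondegenerate too, so the dimension would be even.\<close>
    define a where "a = (\<lambda>v w. b v w + b v e * b w e)"
    interpret alt: char2_form s a
    proof unfold_locales
      show "(1::'a) + 1 = 0" "finite (UNIV :: 'z set)" by (simp_all add: char2 del: one_add_one)
      show "bilinear_form s a"
        unfolding bilinear_form_def Vector_Spaces.linear_def module_hom_def module_hom_axioms_def
        by (auto simp: a_def vector_space_axioms module_axioms vector_space_over_itself.vector_space_axioms
            vector_space_over_itself.module_axioms algebra_simps)
      show "symmetric_form a" by (simp add: symmetric_form_def a_def form_commute mult.commute)
    qed
    have "alt.symplectic UNIV"
      unfolding alt.symplectic_def
    proof (intro conjI ballI impI)
      show "a u u = 0" for u using e[of u] by (simp add: a_def power2_eq_square)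
      fix u assume u: "\<forall>v\<in>UNIV. a u v = 0"
      then have "a u e = 0" by blast
      then have "b u e = 0" by (simp add: a_def e0)
      then have "b u v = 0" for v using u by (simp add: a_def)
      then show "u = 0" by (rule nondegD)
    qed (rule subspace_UNIV)
    then obtain m where "card (UNIV :: 'z set) = CARD('a) ^ (2 * m)"
      using alt.card_symplectic by blast
    then have "dim (UNIV :: 'z set) = 2 * m"
      using card_subspace[OF subspace_UNIV] card_scalar_gt_1 by simp
    then show False using odd by simp
  qed
  moreover have "b e e * b e e = b e e" using e[of e] by (simp add: power2_eq_square)
  ultimately have "b e e = 1" by simp
  then show thesis using that e by blast
qed

end

section \<open>Closed forms of the counts\<close>

definition stabilizer_order :: "nat \<Rightarrow> nat \<Rightarrow> nat \<Rightarrow> nat \<Rightarrow> nat" where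
  "stabilizer_order q m m' k = isotropic_factor q k (m - k) *
     (isotropic_factor q (k + (m' - m)) (m - k) * frame_count q (m - k))"

lemma frame_count_pos:
  assumes "q > 1"
  shows "frame_count q m > 0"
  unfolding frame_count_def
proof (rule prod_pos)
  fix i assume "i \<in> {1..m}"
  then have "1 < q ^ (2 * i)" using assms by (intro one_less_power) auto
  then show "0 < (q ^ (2 * i) - 1) * q ^ (2 * i - 1)" using assms by simp
qed

lemma isotropic_factor_pos:
  assumes "q > 1"
  shows "isotropic_factor q k M > 0"
  unfolding isotropic_factor_def
proof (rule prod_pos)
  fix i assume "i \<in> {1..k}"
  then have "1 < q ^ i" using assms by (intro one_less_power) auto
  then show "0 < (q ^ i - 1) * q ^ (2 * (i + M) - 1)" using assms by simp
qed

lemma stabilizer_order_pos: "q > 1 \<Longrightarrow> stabilizer_order q m m' k > 0"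
  by (simp add: stabilizer_order_def frame_count_pos isotropic_factor_pos)

text \<open>The exponent is the sum of the odd numbers 1, 3, ..., 2m - 1.\<close>

lemma real_frame_count:
  assumes "q > 1"
  shows "real (frame_count q m) = real q ^ (m\<^sup>2) * (\<Prod>i = 1..m. real q ^ (2 * i) - 1)"
proof (induction m)
  case (Suc m)
  have "frame_count q (Suc m) = frame_count q m * ((q ^ (2 * Suc m) - 1) * q ^ (2 * m + 1))"
    by (simp add: frame_count_def)
  moreover have "real (q ^ (2 * Suc m) - 1) = real q ^ (2 * Suc m) - 1"
    using assms by (subst of_nat_diff) auto
  moreover have "(Suc m)\<^sup>2 = m\<^sup>2 + (2 * m + 1)" by (simp add: power2_eq_square)
  then have "real q ^ (Suc m)\<^sup>2 = real q ^ m\<^sup>2 * real q ^ (2 * m + 1)"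
    by (simp only: power_add)
  ultimately show ?case using Suc by (simp only: of_nat_mult of_nat_power) (simp add: ac_simps)
qed (simp add: frame_count_def)

text \<open>The same sum of odd numbers, with each of the \<open>k\<close> terms shifted by
  2M.\<close>

lemma real_isotropic_factor:
  assumes "q > 1"
  shows "real (isotropic_factor q k M) = real q ^ (k\<^sup>2 + 2 * k * M) * (\<Prod>i = 1..k. real q ^ i - 1)"
proof (induction k)
  case (Suc k)
  have "isotropic_factor q (Suc k) M = isotropic_factor q k M * ((q ^ Suc k - 1) * q ^ (2 * k + 2 * M + 1))"
    by (simp add: isotropic_factor_def)
  moreover have "real (q ^ Suc k - 1) = real q ^ Suc k - 1"
    using assms by (subst of_nat_diff) auto
  moreover have "(Suc k)\<^sup>2 + 2 * Suc k * M = (k\<^sup>2 + 2 * k * M) + (2 * k + 2 * M + 1)"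
    by (simp add: power2_eq_square)
  then have "real q ^ ((Suc k)\<^sup>2 + 2 * Suc k * M) = real q ^ (k\<^sup>2 + 2 * k * M) * real q ^ (2 * k + 2 * M + 1)"
    by (simp only: power_add)
  ultimately show ?case using Suc by (simp only: of_nat_mult of_nat_power) (simp add: ac_simps)
qed (simp add: isotropic_factor_def)

text \<open>Each q^(2i) - 1 splits as (q^i - 1)(q^i + 1) and the powers of q agree; the quotient is
  the number of Lagrangians in dimension 2N.\<close>

lemma frame_count_isotropic_factor:
  assumes "q > 1"
  shows "real (frame_count q N) = real (isotropic_factor q N 0) * (\<Prod>i = 1..N. real q ^ i + 1)"
proof -
  have "(\<Prod>i = 1..N. real q ^ (2 * i) - 1) = (\<Prod>i = 1..N. (real q ^ i - 1) * (real q ^ i + 1))"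
    by (intro prod.cong refl) (simp add: algebra_simps power_mult power2_eq_square flip: power_mult_distrib power_add)
  then show ?thesis by (simp add: real_frame_count[OF assms] real_isotropic_factor[OF assms] prod.distrib)
qed

section \<open>Maximal isotropic subspaces of each type and their total mass\<close>

context odd_pair
begin

lemma card_W: "card W = CARD('a) * card U"
proof -
  have "{w \<in> W. b e w = 0} = U" by (auto simp: U_def form_commute[of e])
  then show ?thesis using card_level_set[OF subspaces(1) unit_mem(1) unit_norm(1), of 0] by simp
qed

lemma card_W': "card W' = CARD('a) * card U'"
proof -
  interpret sw: odd_pair s b W' W e' e by (rule swap)
  show ?thesis using sw.card_W by (simp add: sw.U_def U'_def)
qed

lemma maximal_totally_isotropic_iff: "maximal_totally_isotropic s b S \<longleftrightarrow> lagrangian UNIV S"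
proof
  assume S: "lagrangian UNIV S"
  show "maximal_totally_isotropic s b S"
    unfolding maximal_totally_isotropic_def totally_isotropic_def
  proof (intro conjI allI impI)
    show "subspace S" using subspace_lagrangian[OF subspace_UNIV S] .
    show "\<forall>x\<in>S. \<forall>y\<in>S. b x y = 0" using lagrangianD(2)[OF S] by blast
    fix T assume T: "subspace T \<and> (\<forall>x\<in>T. \<forall>y\<in>T. b x y = 0)" and ST: "S \<subseteq> T"
    have "t \<in> S" if "t \<in> T" for t
      by (rule lagrangianD(3)[OF S UNIV_I]) (use T ST that in blast)
    then show "T = S" using ST by blast
  qed
next
  assume "maximal_totally_isotropic s b S"
  then have sS: "subspace S" and iso: "\<And>x y. x \<in> S \<Longrightarrow> y \<in> S \<Longrightarrow> b x y = 0"
    and max: "\<And>T. subspace T \<Longrightarrow> (\<And>x y. x \<in> T \<Longrightarrow> y \<in> T \<Longrightarrow> b x y = 0) \<Longrightarrow> S \<subseteq> T \<Longrightarrow> T = S"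
    unfolding maximal_totally_isotropic_def totally_isotropic_def by blast+
  \<comment> \<open>Maximality absorbs only isotropic vectors orthogonal to \<open>S\<close>.
    Applied to \<open>e + e'\<close> it yields membership in \<open>S\<close>; any vector orthogonal
    to \<open>S\<close> is then orthogonal to \<open>e + e'\<close>, hence isotropic, and is
    absorbed in turn.\<close>
  have absorb: "v \<in> S" if v: "b v v = 0" "\<And>l. l \<in> S \<Longrightarrow> b v l = 0" for v
  proof -
    have "adjoin v S = S"
    proof (rule max[OF subspace_adjoin[OF sS] _ adjoin_superset])
      fix x y assume "x \<in> adjoin v S" "y \<in> adjoin v S"
      then obtain c l d k where "x = s c v + l" "l \<in> S" "y = s d v + k" "k \<in> S" by (metis adjoinE)
      moreover have "b l v = 0" if "l \<in> S" for l using v(2)[OF that] by (simp only: form_commute[of l v])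
      ultimately show "b x y = 0" using v iso by simp
    qed
    then show ?thesis using mem_adjoin_self[OF sS, of v] by simp
  qed
  have ee: "e + e' \<in> S"
  proof (rule absorb)
    show "b (e + e') (e + e') = 0" using unit_norm by simp
    fix l assume "l \<in> S"
    then have "b l (e + e') = 0" using norm_unit[of l] iso by simp
    then show "b (e + e') l = 0" by (simp only: form_commute[of "e + e'" l])
  qed
  show "lagrangian UNIV S"
    unfolding lagrangian_def
  proof (intro conjI ballI iffI)
    fix v assume v: "\<forall>l\<in>S. b v l = 0"
    then have "b v (e + e') = 0" using ee by blast
    then show "v \<in> S" using absorb[of v] v norm_unit[of v] by simp
  qed (use iso in auto)
qed

definition of_type :: "nat \<Rightarrow> 'z set \<Rightarrow> bool" where
  "of_type k S \<longleftrightarrow> lagrangian UNIV S \<and> card (S \<inter> W) = CARD('a) ^ k"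

context
  fixes m m' :: nat
  assumes card_U: "card U = CARD('a) ^ (2 * m)" "card U' = CARD('a) ^ (2 * m')" and le: "m \<le> m'"
begin

lemma of_typeD:
  assumes "of_type k S"
  defines "L \<equiv> S \<inter> osum U U'"
  shows "lagrangian (osum U U') L" "S = adjoin (e + e') L" "card (L \<inter> U) = CARD('a) ^ k" "k \<le> m"
    "card (adapted k (k + (m' - m)) U U' L) = stabilizer_order CARD('a) m m' k"
    "adapted k (k + (m' - m)) U U' L \<noteq> {}"
proof -
  note p = symplectic_pair_U
  have S: "lagrangian UNIV S" "card (S \<inter> W) = CARD('a) ^ k" using assms(1) by (auto simp: of_type_def)
  show L: "lagrangian (osum U U') L" and S_eq: "S = adjoin (e + e') L"
    using lagrangian_UNIV[OF S(1)] by (simp_all add: L_def)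
  show k: "card (L \<inter> U) = CARD('a) ^ k"
    using lagrangian_adjoin_unit(3)[OF L] S(2) S_eq by simp
  note shape = lagrangian_shape_unique[OF p L card_U k]
  show km: "k \<le> m" by (rule shape)
  have "card (L \<inter> U') = CARD('a) ^ (k + (m' - m))" using shape(3) le by simp
  then show card: "card (adapted k (k + (m' - m)) U U' L) = stabilizer_order CARD('a) m m' k"
    unfolding stabilizer_order_def by (rule card_adapted[OF p L k]) (use km le card_U in simp_all)
  \<comment> \<open>The normal form is obtained from the count: a positive number of adapted pairs
    means that there is one.\<close>
  have "stabilizer_order CARD('a) m m' k > 0"
    by (rule stabilizer_order_pos[OF card_scalar_gt_1])
  then show "adapted k (k + (m' - m)) U U' L \<noteq> {}" using card by (metis card.empty less_numeral_extra(3))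
qed

lemma of_type_exists:
  assumes "k \<le> m"
  shows "\<exists>S. of_type k S"
proof -
  note p = symplectic_pair_U
  have "card {B. frame U B} > 0" "card {B. frame U' B} > 0"
    using frame_count_pos card_scalar_gt_1 card_frames[OF symplectic_pairD(1)[OF p] card_U(1)]
      card_frames[OF symplectic_pairD(2)[OF p] card_U(2)] by auto
  then obtain B B' where B: "frame U B" "frame U' B'"
    by (metis (mono_tags) card_gt_0_iff ex_in_conv mem_Collect_eq)
  have "length B = k + (m - k)" "length B' = k + (m' - m) + (m - k)"
    using frame_length_eq[OF symplectic_pairD(1)[OF p] B(1) card_U(1)]
      frame_length_eq[OF symplectic_pairD(2)[OF p] B(2) card_U(2)] assms le by auto
  from lagrangian_frame_lagrangian[OF p B this]
  have "lagrangian (osum U U') (frame_lagrangian k (k + (m' - m)) B B')"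
    "card (frame_lagrangian k (k + (m' - m)) B B' \<inter> U) = CARD('a) ^ k" by auto
  then show ?thesis using lagrangian_adjoin_unit unfolding of_type_def by metis
qed

lemma of_type_transitive:
  assumes S: "of_type k S" and T: "of_type k T"
  shows "\<exists>f\<in>isometry_group. f ` S = T"
proof -
  obtain B B' C C' where "(B, B') \<in> adapted k (k + (m' - m)) U U' (S \<inter> osum U U')"
    "(C, C') \<in> adapted k (k + (m' - m)) U U' (T \<inter> osum U U')"
    using of_typeD(6)[OF S] of_typeD(6)[OF T] by (metis ex_in_conv surj_pair)
  then have "frame U B" "frame U' B'" "frame U C" "frame U' C'"
    "frame_lagrangian k (k + (m' - m)) B B' = S \<inter> osum U U'" "frame_lagrangian k (k + (m' - m)) C C' = T \<inter> osum U U'"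
    by (auto simp: adapted_def)
  then show ?thesis
    using group_transitive of_typeD(2)[OF S] of_typeD(2)[OF T] by metis
qed

lemma card_stabilizer_of_type:
  assumes "of_type k S"
  shows "card {f \<in> isometry_group. f ` S = S} = stabilizer_order CARD('a) m m' k"
proof -
  let ?L = "S \<inter> osum U U'"
  obtain B B' where "(B, B') \<in> adapted k (k + (m' - m)) U U' ?L"
    using of_typeD(6)[OF assms] by (metis ex_in_conv surj_pair)
  from card_stabilizer[OF of_typeD(1)[OF assms] this] show ?thesis
    using of_typeD(2,5)[OF assms] by simp
qed

lemma real_stabilizer_order:
  assumes "k \<le> m"
  shows "real (stabilizer_order CARD('a) m m' k) = real CARD('a) ^ (m'\<^sup>2 + k * (2 * m - k)) * (\<Prod>i = 1..k. real CARD('a) ^ i - 1) *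
    (\<Prod>i = 1..k + (m' - m). real CARD('a) ^ i - 1) * (\<Prod>i = 1..m - k. real CARD('a) ^ (2 * i) - 1)"
proof -
  obtain M where M: "m = k + M" using assms le_Suc_ex by blast
  obtain d where d: "m' = m + d" using le le_Suc_ex by blast
  \<comment> \<open>The three summands are the powers of q from the two isotropic factors and the
    frame count. The last two add up to the square of k + d + M, that is, of \<open>m'\<close>; the
    first is \<open>k * (2 * m - k)\<close>.\<close>
  have "m'\<^sup>2 + k * (2 * m - k) = (k\<^sup>2 + 2 * k * M) + ((k + d)\<^sup>2 + 2 * (k + d) * M) + M\<^sup>2"
    by (simp add: M d power2_eq_square algebra_simps)
  then show ?thesis
    by (simp add: stabilizer_order_def M d real_frame_count[OF card_scalar_gt_1] real_isotropic_factor[OF card_scalar_gt_1]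
        power_add mult_ac)
qed

text \<open>The reciprocal of a stabilizer order is the number of Lagrangians of that type over the
  group order, which is the product of the two frame counts. The sum is thus the number of all
  Lagrangians over the group order.\<close>

lemma mass_formula:
  "(\<Sum>k = 0..m. 1 / real (stabilizer_order CARD('a) m m' k)) =
    (\<Prod>i = 1..m + m'. real CARD('a) ^ i + 1) /
    (real CARD('a) ^ (m\<^sup>2 + m'\<^sup>2) * (\<Prod>i = 1..m. real CARD('a) ^ (2 * i) - 1) *
      (\<Prod>i = 1..m'. real CARD('a) ^ (2 * i) - 1))"
proof -
  note p = symplectic_pair_U and q = card_scalar_gt_1
  let ?T = "\<lambda>k. {L. lagrangian (osum U U') L \<and> card (L \<inter> U) = CARD('a) ^ k}"
  let ?f = "frame_count CARD('a)"
  have "1 / real (stabilizer_order CARD('a) m m' k) = real (card (?T k)) / (real (?f m) * real (?f m'))" if "k \<in> {0..m}" for k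
  proof -
    have mk: "k + (m - k) = m" "k + (m' - m) + (m - k) = m'" using that le by auto
    have "card (?T k) * stabilizer_order CARD('a) m m' k = ?f m * ?f m'"
      using card_lagrangian_type[OF p, of k "m - k" "k + (m' - m)", unfolded mk, OF card_U]
      by (simp only: stabilizer_order_def)
    from arg_cong[OF this, of real]
    have "real (card (?T k)) * real (stabilizer_order CARD('a) m m' k) = real (?f m) * real (?f m')"
      by (simp only: of_nat_mult)
    moreover have "real (stabilizer_order CARD('a) m m' k) > 0" "real (?f m) > 0" "real (?f m') > 0"
      using frame_count_pos[OF q] stabilizer_order_pos[OF q] by simp_all
    ultimately show ?thesis by (simp add: field_simps del: of_nat_mult)
  qed
  then have "(\<Sum>k = 0..m. 1 / real (stabilizer_order CARD('a) m m' k)) = (\<Sum>k = 0..m. real (card (?T k)) / (real (?f m) * real (?f m')))"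
    by (rule sum.cong[OF refl])
  also have "\<dots> = real (\<Sum>k = 0..m. card (?T k)) / (real (?f m) * real (?f m'))"
    by (simp add: sum_divide_distrib)
  also have "(\<Sum>k = 0..m. card (?T k)) = card {L. lagrangian (osum U U') L}"
    by (rule sum_card_lagrangian_type[OF p card_U])
  also have "real (card {L. lagrangian (osum U U') L}) = (\<Prod>i = 1..m + m'. real CARD('a) ^ i + 1)"
  proof -
    have "card (osum U U') = CARD('a) ^ (2 * (m + m'))"
      by (simp add: card_osum[OF p] card_U power_add[symmetric])
    from arg_cong[OF card_lagrangians[OF symplectic_osum[OF p] this], of real]
    have "real (card {L. lagrangian (osum U U') L}) * real (isotropic_factor CARD('a) (m + m') 0) = real (?f (m + m'))"
      by (simp only: of_nat_mult)
    then show ?thesis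
      using frame_count_isotropic_factor[OF q, of "m + m'"] isotropic_factor_pos[OF q, of "m + m'" 0] by simp
  qed
  finally show ?thesis by (simp add: real_frame_count[OF q] power_add mult_ac)
qed

end

end

section \<open>Transfer to the product of two spaces\<close>

lemma linear_iff_add_scale:
  assumes "vector_space s" "vector_space s'"
  shows "Vector_Spaces.linear s s' f \<longleftrightarrow> (\<forall>x y. f (x + y) = f x + f y) \<and> (\<forall>c x. f (s c x) = s' c (f x))"
  using assms
  by (auto simp: Vector_Spaces.linear_def module_hom_def module_hom_axioms_def module_iff_vector_space)

text \<open>An isometry of the sum preserving both axes acts separately on the coordinates. Its
  components are injective, and finiteness makes them bijective.\<close>

lemma perp_isometries_eq:
  fixes s :: "'a::field \<Rightarrow> 'v::ab_group_add \<Rightarrow> 'v" and s' :: "'a \<Rightarrow> 'w::ab_group_add \<Rightarrow> 'w"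
  assumes vs: "vector_space s" "vector_space s'"
    and fin: "finite (UNIV :: 'v set)" "finite (UNIV :: 'w set)"
    and b0: "b 0 0 = 0" "b' 0 0 = 0"
  shows "perp_isometries s b s' b' =
    {f \<in> isometries (module_prod.scale s s') (perp_form b b').
      f ` (UNIV \<times> {0}) \<subseteq> UNIV \<times> {0} \<and> f ` ({0} \<times> UNIV) \<subseteq> {0} \<times> UNIV}" (is "?L = ?R")
proof (intro equalityI subsetI)
  interpret V: vector_space s by (rule vs)
  interpret W: vector_space s' by (rule vs)
  interpret P: vector_space_prod s s' ..
  note lin = linear_iff_add_scale
  fix f assume "f \<in> ?L"
  then obtain g g' where f: "f = map_prod g g'" and g: "g \<in> isometries s b" and g': "g' \<in> isometries s' b'"
    by (auto simp: perp_isometries_def)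
  have l: "\<And>x y. g (x + y) = g x + g y" "\<And>c x. g (s c x) = s c (g x)" "bij g" "\<And>x y. b (g x) (g y) = b x y"
    "\<And>x y. g' (x + y) = g' x + g' y" "\<And>c x. g' (s' c x) = s' c (g' x)" "bij g'" "\<And>x y. b' (g' x) (g' y) = b' x y"
    using g g' by (auto simp: isometries_def lin vs)
  have 0: "g 0 = 0" "g' 0 = 0" using l(2)[of 0 0] l(6)[of 0 0] by auto
  have "bij f" using l(3,7) bij_betw_map_prod[of g UNIV UNIV g' UNIV UNIV] by (simp add: f)
  then show "f \<in> ?R"
    using l 0 by (auto simp: isometries_def lin P.p.vector_space_axioms f perp_form_def P.scale_def)
next
  interpret V: vector_space s by (rule vs)
  interpret W: vector_space s' by (rule vs)
  interpret P: vector_space_prod s s' ..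
  note lin = linear_iff_add_scale
  fix f assume f: "f \<in> ?R"
  have l: "\<And>x y. f (x + y) = f x + f y" "\<And>c x. f (P.scale c x) = P.scale c (f x)" "inj f"
    "\<And>x y. perp_form b b' (f x) (f y) = perp_form b b' x y"
    using f by (auto simp: isometries_def lin P.p.vector_space_axioms bij_def)
  define g where "g = (\<lambda>v. fst (f (v, 0)))"
  define g' where "g' = (\<lambda>w. snd (f (0, w)))"
  have fg: "f (v, 0) = (g v, 0)" for v
  proof -
    have "f (v, 0) \<in> UNIV \<times> {0}" using f by blast
    then show ?thesis by (auto simp: g_def)
  qed
  have fg': "f (0, w) = (0, g' w)" for w
  proof -
    have "f (0, w) \<in> {0} \<times> UNIV" using f by blast
    then show ?thesis by (auto simp: g'_def)
  qed
  have "f (v, w) = (g v, g' w)" for v w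
    using l(1)[of "(v, 0)" "(0, w)"] by (simp add: fg fg')
  then have "f = map_prod g g'" by (auto simp: fun_eq_iff)
  moreover have "g \<in> isometries s b"
  proof -
    have "inj g" using l(3) fg by (metis (no_types, lifting) injD injI prod.inject)
    then have "bij g" using finite_UNIV_inj_surj[OF fin(1)] by (simp add: bij_def)
    moreover have "g (x + y) = g x + g y" for x y using l(1)[of "(x, 0)" "(y, 0)"] by (simp add: fg)
    moreover have "g (s c x) = s c (g x)" for c x using l(2)[of c "(x, 0)"] by (simp add: fg P.scale_def)
    moreover have "b (g x) (g y) = b x y" for x y
      using l(4)[of "(x, 0)" "(y, 0)"] by (simp add: fg perp_form_def b0)
    ultimately show ?thesis by (simp add: isometries_def lin vs)
  qed
  moreover have "g' \<in> isometries s' b'"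
  proof -
    have "inj g'" using l(3) fg' by (metis (no_types, lifting) injD injI prod.inject)
    then have "bij g'" using finite_UNIV_inj_surj[OF fin(2)] by (simp add: bij_def)
    moreover have "g' (x + y) = g' x + g' y" for x y using l(1)[of "(0, x)" "(0, y)"] by (simp add: fg')
    moreover have "g' (s' c x) = s' c (g' x)" for c x using l(2)[of c "(0, x)"] by (simp add: fg' P.scale_def)
    moreover have "b' (g' x) (g' y) = b' x y" for x y
      using l(4)[of "(0, x)" "(0, y)"] by (simp add: fg' perp_form_def b0)
    ultimately show ?thesis by (simp add: isometries_def lin vs)
  qed
  ultimately show "f \<in> ?L" by (auto simp: perp_isometries_def)
qed

theorem corollaryA22:
  fixes s :: "'a::{field,finite} \<Rightarrow> 'v::ab_group_add \<Rightarrow> 'v"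
    and s' :: "'a \<Rightarrow> 'w::ab_group_add \<Rightarrow> 'w"
    and b :: "'v \<Rightarrow> 'v \<Rightarrow> 'a"
    and b' :: "'w \<Rightarrow> 'w \<Rightarrow> 'a"
    and n n' :: nat
    and q :: real
  assumes "CHAR('a) = 2"
    and "q = real CARD('a)"
    and "vector_space s" and "vector_space s'"
    and "vector_space.dim s (UNIV :: 'v set) = n"
    and "vector_space.dim s' (UNIV :: 'w set) = n'"
    and "odd n" and "odd n'" and "n \<le> n'"
    and "bilinear_form s b" and "symmetric_form b"
    and "nondegenerate_form b" and "\<not> alternating_form b"
    and "bilinear_form s' b'" and "symmetric_form b'"
    and "nondegenerate_form b'" and "\<not> alternating_form b'"
  shows
    "(\<forall>k \<le> n div 2. \<exists>S. max_isotropic_meeting s b s' b' k S) \<and>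
     (\<forall>k \<le> n div 2. \<forall>S T.
        max_isotropic_meeting s b s' b' k S \<longrightarrow> max_isotropic_meeting s b s' b' k T \<longrightarrow>
        (\<exists>f \<in> perp_isometries s b s' b'. f ` S = T)) \<and>
     (\<forall>k \<le> n div 2. \<forall>S. max_isotropic_meeting s b s' b' k S \<longrightarrow>
        real (card (perp_stabilizer s b s' b' S)) =
          q ^ ((n' - 1)\<^sup>2 div 4 + k * (n - k - 1))
          * (\<Prod>i = 1..k. (q ^ i - 1))
          * (\<Prod>i = 1..k + (n' - n) div 2. (q ^ i - 1))
          * (\<Prod>i = 1..(n - 1) div 2 - k. (q ^ (2 * i) - 1))) \<and>
     (\<forall>S. (\<forall>k \<le> n div 2. max_isotropic_meeting s b s' b' k (S k)) \<longrightarrow>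
        (\<Sum>k = 0..(n - 1) div 2. 1 / real (card (perp_stabilizer s b s' b' (S k)))) =
          (\<Prod>i = 1..(n + n') div 2 - 1. (q ^ i + 1))
          / (q ^ ((n - 1)\<^sup>2 div 4 + (n' - 1)\<^sup>2 div 4)
             * (\<Prod>i = 1..(n - 1) div 2. (q ^ (2 * i) - 1))
             * (\<Prod>i = 1..(n' - 1) div 2. (q ^ (2 * i) - 1))))"
proof -
  note vs = \<open>vector_space s\<close> \<open>vector_space s'\<close>
  have "of_nat CHAR('a) = (0 :: 'a)" by (rule of_nat_CHAR)
  then have char2: "(1 :: 'a) + 1 = 0" by (simp add: \<open>CHAR('a) = 2\<close>)
  have fin: "finite (UNIV :: 'v set)" "finite (UNIV :: 'w set)"
    using finite_UNIV_if_dim[OF vs(1)] finite_UNIV_if_dim[OF vs(2)] assms(5-8) odd_pos by auto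
  interpret V: char2_form s b
    using vs(1) char2 fin(1) \<open>bilinear_form s b\<close> \<open>symmetric_form b\<close>
    by (simp only: char2_form_def char2_form_axioms_def simp_thms)
  interpret W: char2_form s' b'
    using vs(2) char2 fin(2) \<open>bilinear_form s' b'\<close> \<open>symmetric_form b'\<close>
    by (simp only: char2_form_def char2_form_axioms_def simp_thms)
  interpret P: vector_space_prod s s' ..
  obtain e where e: "b e e = 1" "\<And>v. b v v = (b v e)\<^sup>2"
    using V.unit_exists[OF \<open>nondegenerate_form b\<close>] \<open>odd n\<close> assms(5) by blast
  obtain e' where e': "b' e' e' = 1" "\<And>v. b' v v = (b' v e')\<^sup>2"
    using W.unit_exists[OF \<open>nondegenerate_form b'\<close>] \<open>odd n'\<close> assms(6) by blast
  define c where "c = perp_form b b'"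
  have c_pair: "c (v, w) (x, y) = b v x + b' w y" for v w x y by (simp add: c_def perp_form_def)
  have c_fs: "c x y = b (fst x) (fst y) + b' (snd x) (snd y)" for x y by (simp add: c_def perp_form_def)
  interpret Z: char2_form P.scale c
  proof unfold_locales
    show "(1::'a) + 1 = 0" by (rule char2)
    show "finite (UNIV :: ('v \<times> 'w) set)" by (rule finite_Prod_UNIV[OF fin])
    show "bilinear_form P.scale c"
      unfolding bilinear_form_def linear_iff_add_scale[OF P.p.vector_space_axioms vector_space_over_itself.vector_space_axioms]
      by (auto simp: c_fs P.scale_def distrib_left ac_simps)
    show "symmetric_form c"
      by (simp add: symmetric_form_def c_fs V.form_commute W.form_commute)
  qed
  interpret Z: odd_pair P.scale c "UNIV \<times> {0}" "{0} \<times> UNIV" "(e, 0)" "(0, e')"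
  proof unfold_locales
    show "nondegenerate_form c"
      unfolding nondegenerate_form_def
    proof (intro allI impI)
      fix x :: "'v \<times> 'w" assume x: "\<forall>y. c x y = 0"
      have "b (fst x) v = 0" for v using x[rule_format, of "(v, 0)"] by (simp add: c_fs)
      moreover have "b' (snd x) w = 0" for w using x[rule_format, of "(0, w)"] by (simp add: c_fs)
      ultimately show "x = 0"
        using \<open>nondegenerate_form b\<close> \<open>nondegenerate_form b'\<close> by (auto simp: nondegenerate_form_def prod_eq_iff)
    qed
    show "P.p.subspace (UNIV \<times> {0})" "P.p.subspace ({0} \<times> UNIV)"
      by (auto simp: P.p.subspace_def P.scale_def zero_prod_def)
    show "Z.osum (UNIV \<times> {0}) ({0} \<times> UNIV) = UNIV"
      using Z.osumI[of "(fst z, 0)" "UNIV \<times> {0}" "(0, snd z)" "{0} \<times> UNIV" for z] by (auto simp: set_eq_iff)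
  qed (auto simp: c_pair e(1) e'(1) e(2)[symmetric] e'(2)[symmetric])
  obtain m m' where n: "n = 2 * m + 1" "n' = 2 * m' + 1" using \<open>odd n\<close> \<open>odd n'\<close> by (auto elim!: oddE)
  have le: "m \<le> m'" using \<open>n \<le> n'\<close> n by simp
  have "card (UNIV :: 'v set) = CARD('a) ^ n" "card (UNIV :: 'w set) = CARD('a) ^ n'"
    using V.card_subspace[OF V.subspace_UNIV] W.card_subspace[OF W.subspace_UNIV] assms(5,6) by auto
  then have "card ((UNIV :: 'v set) \<times> {0 :: 'w}) = CARD('a) ^ n" "card ({0 :: 'v} \<times> (UNIV :: 'w set)) = CARD('a) ^ n'"
    by (simp_all add: card_cartesian_product)
  then have card_U: "card Z.U = CARD('a) ^ (2 * m)" "card Z.U' = CARD('a) ^ (2 * m')"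
    using Z.card_W Z.card_W' by (simp_all add: n)
  have group: "perp_isometries s b s' b' = Z.isometry_group"
    unfolding Z.isometry_group_def unfolding c_def by (rule perp_isometries_eq[OF vs fin]) simp_all
  then have stab: "perp_stabilizer s b s' b' S = {f \<in> Z.isometry_group. f ` S = S}" for S
    by (simp add: perp_stabilizer_def)
  have type: "max_isotropic_meeting s b s' b' k S \<longleftrightarrow> Z.of_type k S" for k S
  proof -
    \<comment> \<open>Size and dimension are compared for subspaces only, so the Lagrangian property
      is needed before the two descriptions of the type can be exchanged.\<close>
    have "P.p.dim (S \<inter> UNIV \<times> {0}) = k \<longleftrightarrow> card (S \<inter> UNIV \<times> {0}) = CARD('a) ^ k" if "Z.lagrangian UNIV S"
    proof -
      have "P.p.subspace (S \<inter> UNIV \<times> {0})"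
        by (intro P.p.subspace_inter Z.subspace_lagrangian[OF P.p.subspace_UNIV that] Z.subspaces)
      from Z.card_subspace[OF this] show ?thesis using V.card_scalar_gt_1 by auto
    qed
    then show ?thesis
      unfolding max_isotropic_meeting_def Z.of_type_def Z.maximal_totally_isotropic_iff[symmetric] c_def[symmetric]
      by blast
  qed
  \<comment> \<open>As \<open>n\<close> and \<open>n'\<close> are odd, all these divisions are
    exact: \<open>(n - 1)\<^sup>2\<close> is 4 times the square of \<open>m\<close>, and the upper
    limit of the numerator is m + m'.\<close>
  have arith: "n div 2 = m" "(n - 1) div 2 = m" "(n' - 1) div 2 = m'" "(n' - n) div 2 = m' - m"
    "(n + n') div 2 - 1 = m + m'" "(n - 1)\<^sup>2 div 4 = m\<^sup>2" "(n' - 1)\<^sup>2 div 4 = m'\<^sup>2" "n - k - 1 = 2 * m - k" for k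
    using le by (auto simp: n power_mult_distrib)
  have count: "real (card (perp_stabilizer s b s' b' S)) = real (stabilizer_order CARD('a) m m' k)"
    if "max_isotropic_meeting s b s' b' k S" for k S
    using Z.card_stabilizer_of_type[OF card_U le] that by (simp add: stab type)
  show ?thesis
    unfolding arith \<open>q = real CARD('a)\<close>
  proof (intro conjI allI impI)
    show "\<exists>S. max_isotropic_meeting s b s' b' k S" if "k \<le> m" for k
      using Z.of_type_exists[OF card_U le that] by (simp add: type)
    show "\<exists>f\<in>perp_isometries s b s' b'. f ` S = T"
      if "max_isotropic_meeting s b s' b' k S" "max_isotropic_meeting s b s' b' k T" for k S T
      using Z.of_type_transitive[OF card_U le] that by (simp add: type group)
    show "real (card (perp_stabilizer s b s' b' S)) =
        real CARD('a) ^ (m'\<^sup>2 + k * (2 * m - k)) * (\<Prod>i = 1..k. real CARD('a) ^ i - 1) *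
        (\<Prod>i = 1..k + (m' - m). real CARD('a) ^ i - 1) * (\<Prod>i = 1..m - k. real CARD('a) ^ (2 * i) - 1)"
      if "k \<le> m" "max_isotropic_meeting s b s' b' k S" for k S
      using count[OF that(2)] Z.real_stabilizer_order[OF card_U le that(1)] by (simp only:)
    fix S assume S: "\<forall>k\<le>m. max_isotropic_meeting s b s' b' k (S k)"
    have "(\<Sum>k = 0..m. 1 / real (card (perp_stabilizer s b s' b' (S k)))) =
        (\<Sum>k = 0..m. 1 / real (stabilizer_order CARD('a) m m' k))"
      by (rule sum.cong[OF refl]) (use S count in auto)
    then show "(\<Sum>k = 0..m. 1 / real (card (perp_stabilizer s b s' b' (S k)))) =
        (\<Prod>i = 1..m + m'. real CARD('a) ^ i + 1) /
        (real CARD('a) ^ (m\<^sup>2 + m'\<^sup>2) * (\<Prod>i = 1..m. real CARD('a) ^ (2 * i) - 1) *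
          (\<Prod>i = 1..m'. real CARD('a) ^ (2 * i) - 1))"
      using Z.mass_formula[OF card_U le] by (simp only:)
  qed
qed

end
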